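(* Let $\alpha\in(0,1)$, $1\le p\le\infty$ and $X=\ell^p(\mathbb{C})$. For $x_0\in X$ let $x(n)=(x_k(n))_{k\in\mathbb{Z}}$, $n\ge0$, be the solution of $$x_k(n+1)=(1-\alpha)x_k(n)+\alpha x_{k-1}(n),\qquad k\in\mathbb{Z},\ n\ge0,$$ with initial data $x(0)=x_0$. Let $S$ be the right shift on $X$. Then the following hold. (a) The solution converges to a limit in the norm of $X$ if and only if there exists $c\in\mathbb{C}$ such that the constant sequence $y$ with entry $c$ is an element of $X$ and $$\bigg\|\frac1n\sum_{j=1}^nS^jx_0-y\bigg\|_X\to0,\qquad n\to\infty.\tag{$*$}$$ Moreover, if this is the case then $\|x(n)-y\|_X\to0$ as $n\to\infty$. In particular, all initial vectors $x_0\in X$ lead to convergence if and only if $1<p<\infty$, and if $1\le p<\infty$ then the only possible candidate for $c$ is $0$. (b) If $x_0\in X$ is such that the convergence in $( * )$ holds with rate $O(n^{-1})$ as $n\to\infty$ (for some $y$ as in (a)), then, with this $y$, $\|x(n)-y\|_X=O(n^{-1/2})$ as $n\to\infty$. (c) For all $x_0\in X$ we have $\|x(n+1)-x(n)\|_X=O(n^{-1/2})$ as $n\to\infty$. Furthermore, the rates in (b) and (c) are optimal, in the sense that if in (b) or in (c) the rate $n^{-1/2}$ were replaced by $r_n$ for some sequence $r_n>0$, $n\ge1$, with $r_n=o(n^{-1/2})$ as $n\to\infty$, then the corresponding statement would become false.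
   Context: $\ell^p(\mathbb{C})$ denotes the Banach space of doubly infinite sequences $x=(x_k)_{k\in\mathbb{Z}}$ of complex numbers with the usual $p$-norm (supremum norm if $p=\infty$). The right shift $S$ on $X$ is defined by $S(x_k)=(x_{k-1})$. *)

theory Defs
  imports "HOL-Analysis.Analysis" "HOL-Library.Landau_Symbols"
begin

text \<open>
  The space of doubly infinite complex \<open>p\<close>-summable (for \<open>p = \<infinity>\<close>: bounded) sequences and its norm,
  for an exponent \<open>p\<close> in the extended reals. Both are only meaningful for \<open>1 \<le> p\<close>, and
  \<open>lp_norm p x\<close> only for \<open>x \<in> lp p\<close>: elsewhere the infinite sum or the supremum has a default value.
\<close>

definition lp :: "ereal \<Rightarrow> (int \<Rightarrow> complex) set" where
  "lp p = (if p = \<infinity> then {x. bounded (range x)}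
           else {x. (\<lambda>k. norm (x k) powr real_of_ereal p) summable_on UNIV})"

definition lp_norm :: "ereal \<Rightarrow> (int \<Rightarrow> complex) \<Rightarrow> real" where
  "lp_norm p x = (if p = \<infinity> then (SUP k. norm (x k))
                  else (\<Sum>\<^sub>\<infinity>k. norm (x k) powr real_of_ereal p) powr (1 / real_of_ereal p))"

definition const_seq :: "complex \<Rightarrow> int \<Rightarrow> complex" where
  "const_seq c = (\<lambda>k. c)"

definition right_shift :: "(int \<Rightarrow> complex) \<Rightarrow> int \<Rightarrow> complex" where
  "right_shift x = (\<lambda>k. x (k - 1))"

definition shift_mean :: "(int \<Rightarrow> complex) \<Rightarrow> nat \<Rightarrow> int \<Rightarrow> complex" where
  "shift_mean x0 n = (\<lambda>k. (1 / of_nat n) * (\<Sum>j=1..n. (right_shift ^^ j) x0 k))"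

primrec solution :: "real \<Rightarrow> (int \<Rightarrow> complex) \<Rightarrow> nat \<Rightarrow> int \<Rightarrow> complex" where
  "solution \<alpha> x0 0 = x0"
| "solution \<alpha> x0 (Suc n) =
     (\<lambda>k. of_real (1 - \<alpha>) * solution \<alpha> x0 n k + of_real \<alpha> * solution \<alpha> x0 n (k - 1))"

definition solution_converges :: "ereal \<Rightarrow> real \<Rightarrow> (int \<Rightarrow> complex) \<Rightarrow> bool" where
  "solution_converges p \<alpha> x0 \<longleftrightarrow>
     (\<exists>z\<in>lp p. (\<lambda>n. lp_norm p (solution \<alpha> x0 n - z)) \<longlonglongrightarrow> 0)"

end

theory Submission
  imports Defs "HOL-Library.Discrete_Functions"
begin

text \<open>
  Write \<open>T = (1 - \<alpha>) I + \<alpha> S\<close>, so that \<open>T ^ n = (\<Sum>j\<le>n. B n j * S ^ j)\<close> with binomial weights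
  \<open>B n j\<close> (the Bernstein polynomials at \<open>\<alpha>\<close>). The difference \<open>B n j - B n (j - 1)\<close> is a multiple
  of \<open>((n + 1) * \<alpha> - j) * B (n + 1) j\<close>, so the variance of the binomial distribution bounds the
  total variation of the weights by \<open>O(n powr (- 1 / 2))\<close>; summation by parts gives (b) and (c).
  For (a), the Cesaro means of \<open>w\<close> and the iterates \<open>T ^ n w\<close> tend to zero under the same
  condition, namely that \<open>w\<close> lies in the closure of the range of \<open>I - S\<close>. Optimality is a gliding
  hump: on each dyadic block a sequence is geometric with ratio close to 1, hence an approximate
  eigenvector of \<open>T ^ n (I - S)\<close> with eigenvalue of modulus comparable to \<open>n powr (- 1 / 2)\<close>; the
  norms of the blocks are summable but decay more slowly than the proposed rate permits.
\<close>

subsection \<open>The norm of \<open>lp\<close>\<close>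

text \<open>On the positive reals this is convexity of the power. The endpoint 0 is treated apart,
  through \<open>s powr q \<le> s\<close> for \<open>0 \<le> s \<le> 1\<close>.\<close>

lemma powr_convex_comb:
  fixes x y t q :: real
  assumes "1 \<le> q" "0 \<le> x" "0 \<le> y" "0 \<le> t" "t \<le> 1"
  shows "(t * x + (1 - t) * y) powr q \<le> t * x powr q + (1 - t) * y powr q"
proof -
  have scale: "(s * z) powr q \<le> s * z powr q" if "0 \<le> s" "s \<le> 1" "0 \<le> z" for s z :: real
  proof -
    have "s powr q \<le> s"
      using that powr_mono'[of 1 q s] assms(1) by auto
    then show ?thesis
      using that by (simp add: powr_mult mult_right_mono)
  qed
  show ?thesis
  proof (cases "x = 0 \<or> y = 0")
    case True
    then show ?thesis
      using scale[of t x] scale[of "1 - t" y] assms by auto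
  next
    case False
    then have "x > 0" "y > 0" using assms by auto
    then show ?thesis
      using convex_onD[OF powr_convex[OF assms(1)], of "1 - t" x y] assms by simp
  qed
qed

text \<open>For \<open>0 \<le> B\<close> this says at once that \<open>x\<close> lies in
  \<open>lp p\<close> and has norm at most \<open>B\<close>. Stated with finite sums, it can be
  verified without any summability argument.\<close>

definition lp_bound :: "ereal \<Rightarrow> real \<Rightarrow> (int \<Rightarrow> complex) \<Rightarrow> bool" where
  "lp_bound p B x \<longleftrightarrow>
     (if p = \<infinity> then \<forall>k. norm (x k) \<le> B
      else \<forall>F. finite F \<longrightarrow> (\<Sum>k\<in>F. norm (x k) powr real_of_ereal p) \<le> B powr real_of_ereal p)"

locale lp_exponent =
  fixes p :: ereal
  assumes p_ge_1: "1 \<le> p"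
begin

abbreviation q :: real where "q \<equiv> real_of_ereal p"

lemma p_eq: "p \<noteq> \<infinity> \<Longrightarrow> p = ereal q"
  using p_ge_1 by (cases p) auto

lemma q_ge_1: "p \<noteq> \<infinity> \<Longrightarrow> 1 \<le> q"
  using p_ge_1 p_eq by (metis ereal_less_eq(3) one_ereal_def)

lemma lp_norm_nonneg: "x \<in> lp p \<Longrightarrow> 0 \<le> lp_norm p x"
proof (cases "p = \<infinity>")
  case True
  assume "x \<in> lp p"
  then have "bounded (range x)" using True by (simp add: lp_def)
  then have "bdd_above (range (\<lambda>k. norm (x k)))"
    by (force simp: bounded_iff bdd_above_def)
  then have "norm (x 0) \<le> (SUP k. norm (x k))" by (rule cSUP_upper2) auto
  then have "0 \<le> (SUP k. norm (x k))" using norm_ge_zero[of "x 0"] by linarith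
  then show ?thesis using True by (simp add: lp_norm_def)
qed (simp add: lp_norm_def)

text \<open>Bounded finite sums of nonnegative terms force summability, and the infinite sum
  inherits the bound. Together with \<open>lp_bound_norm\<close> this reduces norm estimates to
  finite sets.\<close>

lemma lp_norm_boundI:
  assumes "0 \<le> B" "lp_bound p B x"
  shows "x \<in> lp p" "lp_norm p x \<le> B"
proof -
  have "x \<in> lp p \<and> lp_norm p x \<le> B"
  proof (cases "p = \<infinity>")
    case True
    then have "norm (x k) \<le> B" for k using assms by (simp add: lp_bound_def)
    then show ?thesis
      using True by (auto simp: lp_def lp_norm_def bounded_iff intro: cSUP_least)
  next
    case False
    have le: "(\<Sum>k\<in>F. norm (x k) powr q) \<le> B powr q" if "finite F" for F
      using assms False that by (simp add: lp_bound_def)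
    have s: "(\<lambda>k. norm (x k) powr q) summable_on UNIV"
      by (rule nonneg_bdd_above_summable_on) (auto intro!: bdd_aboveI[of _ "B powr q"] le)
    have "(\<Sum>\<^sub>\<infinity>k. norm (x k) powr q) \<le> B powr q"
      by (rule infsum_le_finite_sums[OF s]) (use le in auto)
    then have "(\<Sum>\<^sub>\<infinity>k. norm (x k) powr q) powr (1 / q) \<le> (B powr q) powr (1 / q)"
      using q_ge_1[OF False] by (intro powr_mono2 infsum_nonneg) auto
    also have "\<dots> = B" using q_ge_1[OF False] assms by (simp add: powr_powr)
    finally show ?thesis using False s by (simp add: lp_def lp_norm_def)
  qed
  then show "x \<in> lp p" "lp_norm p x \<le> B" by auto
qed

lemma lp_bound_norm:
  assumes "x \<in> lp p"
  shows "lp_bound p (lp_norm p x) x"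
proof (cases "p = \<infinity>")
  case True
  then have "bounded (range x)" using assms by (simp add: lp_def)
  then have "bdd_above (range (\<lambda>k. norm (x k)))"
    by (force simp: bounded_iff bdd_above_def)
  then show ?thesis using True by (auto simp: lp_bound_def lp_norm_def intro: cSUP_upper)
next
  case False
  have s: "(\<lambda>k. norm (x k) powr q) summable_on UNIV"
    using assms False by (simp add: lp_def)
  have "(lp_norm p x) powr q = (\<Sum>\<^sub>\<infinity>k. norm (x k) powr q)"
    using False q_ge_1[OF False]
    by (simp add: lp_norm_def powr_powr infsum_nonneg)
  then show ?thesis
    using False s by (auto simp: lp_bound_def intro!: finite_sum_le_infsum)
qed

lemma lp_bound_mono:
  assumes "lp_bound p B y" "\<And>k. norm (x k) \<le> norm (y k)"
  shows "lp_bound p B x"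
proof (cases "p = \<infinity>")
  case True
  then show ?thesis using assms by (auto simp: lp_bound_def intro: order_trans)
next
  case False
  have "(\<Sum>k\<in>F. norm (x k) powr q) \<le> (\<Sum>k\<in>F. norm (y k) powr q)" for F
    using assms(2) q_ge_1[OF False] by (intro sum_mono powr_mono2) auto
  then show ?thesis
    using False assms(1) by (auto simp: lp_bound_def intro: order_trans)
qed

lemma lp_mono:
  assumes "y \<in> lp p" "\<And>k. norm (x k) \<le> norm (y k)"
  shows "x \<in> lp p" "lp_norm p x \<le> lp_norm p y"
  using lp_norm_boundI[OF lp_norm_nonneg lp_bound_mono[OF lp_bound_norm], OF assms(1) assms]
  by simp_all

lemma lp_zero: "(\<lambda>k. 0) \<in> lp p" "lp_norm p (\<lambda>k. 0) = 0"
proof -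
  have "lp_bound p 0 (\<lambda>k. 0)" by (simp add: lp_bound_def)
  from lp_norm_boundI[OF _ this] show "(\<lambda>k. 0) \<in> lp p" "lp_norm p (\<lambda>k. 0) = 0"
    using lp_norm_nonneg by (auto intro: antisym)
qed

lemma lp_bound_scale:
  assumes "0 \<le> B" "lp_bound p B x"
  shows "lp_bound p (norm a * B) (\<lambda>k. a * x k)"
proof (cases "p = \<infinity>")
  case True
  then show ?thesis using assms by (auto simp: lp_bound_def norm_mult intro: mult_left_mono)
next
  case False
  have "(\<Sum>k\<in>F. norm (a * x k) powr q) = norm a powr q * (\<Sum>k\<in>F. norm (x k) powr q)" for F
    by (simp add: norm_mult powr_mult sum_distrib_left)
  then show ?thesis
    using assms False by (auto simp: lp_bound_def powr_mult intro: mult_left_mono)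
qed

lemma lp_scale:
  assumes "x \<in> lp p"
  shows "(\<lambda>k. a * x k) \<in> lp p" "lp_norm p (\<lambda>k. a * x k) = norm a * lp_norm p x"
proof -
  \<comment> \<open>One inequality is enough: used for \<open>inverse a\<close> and
    \<open>a * x\<close> it gives the reverse one.\<close>
  have *: "(\<lambda>k. b * y k) \<in> lp p \<and> lp_norm p (\<lambda>k. b * y k) \<le> norm b * lp_norm p y"
    if "y \<in> lp p" for b y
    using lp_norm_boundI[OF _ lp_bound_scale[OF lp_norm_nonneg lp_bound_norm, OF that that]]
      lp_norm_nonneg[OF that] by simp
  show "(\<lambda>k. a * x k) \<in> lp p" using * assms by blast
  show "lp_norm p (\<lambda>k. a * x k) = norm a * lp_norm p x"
  proof (cases "a = 0")
    case True
    then show ?thesis using lp_zero by simp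
  next
    case False
    have "lp_norm p (\<lambda>k. inverse a * (a * x k)) \<le> norm (inverse a) * lp_norm p (\<lambda>k. a * x k)"
      using * assms by blast
    then have "norm a * lp_norm p x \<le> lp_norm p (\<lambda>k. a * x k)"
      using False by (simp add: norm_divide field_simps)
    then show ?thesis using * assms by (simp add: order_antisym)
  qed
qed

text \<open>Minkowski's inequality, from the convexity of \<open>t \<mapsto> t powr q\<close> applied to the normalised sequences.\<close>

lemma lp_bound_add:
  assumes "0 < A" "0 < B" "lp_bound p A x" "lp_bound p B y"
  shows "lp_bound p (A + B) (\<lambda>k. x k + y k)"
proof (cases "p = \<infinity>")
  case True
  then show ?thesis using assms by (auto simp: lp_bound_def intro: norm_triangle_mono)
next
  case False
  note q = q_ge_1[OF False]
  have "(\<Sum>k\<in>F. norm (x k + y k) powr q) \<le> (A + B) powr q" if F: "finite F" for F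
  proof -
    define t where "t = A / (A + B)"
    have t: "0 \<le> t" "t \<le> 1" using assms by (auto simp: t_def field_simps)
    have pt: "norm (x k + y k) powr q
        \<le> (A + B) powr q * (t * (norm (x k) / A) powr q + (1 - t) * (norm (y k) / B) powr q)" for k
    proof -
      have "norm (x k + y k) \<le> (A + B) * (t * (norm (x k) / A) + (1 - t) * (norm (y k) / B))"
      proof -
        have "(A + B) * t = A" "(A + B) * (1 - t) = B"
          using assms by (auto simp: t_def field_simps)
        then have "(A + B) * (t * (norm (x k) / A) + (1 - t) * (norm (y k) / B)) = norm (x k) + norm (y k)"
          using assms by (simp add: distrib_left flip: mult.assoc)
        then show ?thesis by (simp add: norm_triangle_ineq)
      qed
      then have "norm (x k + y k) powr q
          \<le> ((A + B) * (t * (norm (x k) / A) + (1 - t) * (norm (y k) / B))) powr q"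
        using q by (intro powr_mono2) auto
      also have "\<dots> = (A + B) powr q * (t * (norm (x k) / A) + (1 - t) * (norm (y k) / B)) powr q"
        by (simp only: powr_mult)
      also have "\<dots> \<le> (A + B) powr q * (t * (norm (x k) / A) powr q + (1 - t) * (norm (y k) / B) powr q)"
        using assms q t by (intro mult_left_mono powr_convex_comb) auto
      finally show ?thesis .
    qed
    have "(\<Sum>k\<in>F. (norm (x k) / A) powr q) \<le> 1" "(\<Sum>k\<in>F. (norm (y k) / B) powr q) \<le> 1"
      using assms F False by (auto simp: powr_divide lp_bound_def simp flip: sum_divide_distrib)
    then have "t * (\<Sum>k\<in>F. (norm (x k) / A) powr q) + (1 - t) * (\<Sum>k\<in>F. (norm (y k) / B) powr q)
        \<le> t * 1 + (1 - t) * 1"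
      using t by (intro add_mono mult_left_mono) auto
    then have "(\<Sum>k\<in>F. t * (norm (x k) / A) powr q + (1 - t) * (norm (y k) / B) powr q) \<le> 1"
      by (simp add: sum.distrib sum_distrib_left)
    then have "(A + B) powr q * (\<Sum>k\<in>F. t * (norm (x k) / A) powr q + (1 - t) * (norm (y k) / B) powr q)
        \<le> (A + B) powr q * 1"
      by (intro mult_left_mono) auto
    moreover have "(\<Sum>k\<in>F. norm (x k + y k) powr q)
        \<le> (A + B) powr q * (\<Sum>k\<in>F. t * (norm (x k) / A) powr q + (1 - t) * (norm (y k) / B) powr q)"
      unfolding sum_distrib_left by (rule sum_mono) (rule pt)
    ultimately show ?thesis by linarith
  qed
  then show ?thesis using False by (simp add: lp_bound_def)
qed

lemma lp_bound_weaken: "0 \<le> A \<Longrightarrow> A \<le> B \<Longrightarrow> lp_bound p A x \<Longrightarrow> lp_bound p B x"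
  using q_ge_1 powr_mono2[of q A B] unfolding lp_bound_def
  by (cases "p = \<infinity>") (auto intro: order_trans)

lemma lp_add:
  assumes "x \<in> lp p" "y \<in> lp p"
  shows "(\<lambda>k. x k + y k) \<in> lp p"
    "lp_norm p (\<lambda>k. x k + y k) \<le> lp_norm p x + lp_norm p y"
proof -
  \<comment> \<open>\<open>lp_bound_add\<close> divides by the bounds, so each norm is enlarged by
    \<open>e / 2\<close> to make it positive; then \<open>e\<close> tends to 0.\<close>
  have *: "(\<lambda>k. x k + y k) \<in> lp p \<and> lp_norm p (\<lambda>k. x k + y k) \<le> lp_norm p x + lp_norm p y + e"
    if "0 < e" for e
  proof -
    have "lp_bound p ((lp_norm p x + e / 2) + (lp_norm p y + e / 2)) (\<lambda>k. x k + y k)"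
      using that assms lp_norm_nonneg
      by (intro lp_bound_add lp_bound_weaken[OF _ _ lp_bound_norm] add_nonneg_pos) auto
    from lp_norm_boundI[OF _ this] show ?thesis
      using that assms lp_norm_nonneg[of x] lp_norm_nonneg[of y] by (simp add: algebra_simps)
  qed
  show "(\<lambda>k. x k + y k) \<in> lp p" using *[of 1] by simp
  show "lp_norm p (\<lambda>k. x k + y k) \<le> lp_norm p x + lp_norm p y"
    by (rule field_le_epsilon) (use * in blast)
qed

lemma lp_diff:
  assumes "x \<in> lp p" "y \<in> lp p"
  shows "x - y \<in> lp p" "lp_norm p (x - y) \<le> lp_norm p x + lp_norm p y"
  using lp_add[OF assms(1) lp_scale(1)[OF assms(2), of "-1"]] lp_scale(2)[OF assms(2), of "-1"]
  by (auto simp: fun_diff_def)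

text \<open>Solutions and Cesaro means are both finite combinations of translates of the initial
  sequence; their norms are controlled through this form of the triangle inequality.\<close>

lemma lp_lincomb:
  assumes "finite A" "\<And>j. j \<in> A \<Longrightarrow> x j \<in> lp p"
  shows "(\<lambda>k. \<Sum>j\<in>A. c j * x j k) \<in> lp p \<and>
    lp_norm p (\<lambda>k. \<Sum>j\<in>A. c j * x j k) \<le> (\<Sum>j\<in>A. norm (c j) * lp_norm p (x j))"
  using assms
proof (induction A)
  case empty
  then show ?case using lp_zero by simp
next
  case (insert a A)
  have "(\<lambda>k. c a * x a k) \<in> lp p" "lp_norm p (\<lambda>k. c a * x a k) = norm (c a) * lp_norm p (x a)"
    using lp_scale insert by auto
  with insert lp_add[of "\<lambda>k. c a * x a k" "\<lambda>k. \<Sum>j\<in>A. c j * x j k"]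
  show ?case by fastforce
qed

lemma lp_bound_translate:
  assumes "lp_bound p B x"
  shows "lp_bound p B (\<lambda>k. x (k - m))"
proof (cases "p = \<infinity>")
  case True
  then show ?thesis using assms by (auto simp: lp_bound_def)
next
  case False
  have "(\<Sum>k\<in>F. norm (x (k - m)) powr q) = (\<Sum>k\<in>(\<lambda>k. k - m) ` F. norm (x k) powr q)" for F
    by (subst sum.reindex) (auto simp: inj_on_def)
  then show ?thesis using assms False by (simp add: lp_bound_def)
qed

lemma lp_translate:
  assumes "x \<in> lp p"
  shows "(\<lambda>k. x (k - m)) \<in> lp p" "lp_norm p (\<lambda>k. x (k - m)) = lp_norm p x"
proof -
  have *: "(\<lambda>k. y (k - m)) \<in> lp p \<and> lp_norm p (\<lambda>k. y (k - m)) \<le> lp_norm p y"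
    if "y \<in> lp p" for y m
    using lp_norm_boundI[OF lp_norm_nonneg lp_bound_translate[OF lp_bound_norm], OF that that]
    by simp
  show "(\<lambda>k. x (k - m)) \<in> lp p" using * assms by blast
  then have "lp_norm p (\<lambda>k. x (k - (- m) - m)) \<le> lp_norm p (\<lambda>k. x (k - m))"
    using *[of "\<lambda>k. x (k - m)" "- m"] by blast
  then show "lp_norm p (\<lambda>k. x (k - m)) = lp_norm p x"
    using * assms by (simp add: order_antisym)
qed

lemma norm_le_lp_norm:
  assumes "x \<in> lp p"
  shows "norm (x k) \<le> lp_norm p x"
proof (cases "p = \<infinity>")
  case True
  then show ?thesis using lp_bound_norm[OF assms] by (simp add: lp_bound_def)
next
  case False
  have "(\<Sum>k\<in>{k}. norm (x k) powr q) \<le> lp_norm p x powr q"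
    using lp_bound_norm[OF assms] False unfolding lp_bound_def by (metis finite.emptyI finite_insert)
  then have "norm (x k) powr q \<le> lp_norm p x powr q" by simp
  then show ?thesis
    using q_ge_1[OF False] lp_norm_nonneg[OF assms] by (meson less_le_trans not_le powr_less_mono2 norm_ge_zero zero_less_one)
qed

end

subsection \<open>Binomial weights\<close>

text \<open>Pascal's rule. For \<open>n < Suc j\<close> the coefficient
  \<open>n choose Suc j\<close> vanishes, so the truncated exponent \<open>n - Suc j\<close> does no
  harm.\<close>

lemma Bernstein_Suc_Suc:
  "Bernstein (Suc n) (Suc j) a = (1 - a) * Bernstein n (Suc j) a + a * Bernstein n j a"
proof (cases "Suc j \<le> n")
  case True
  then have "n - j = Suc (n - Suc j)" by simp
  then show ?thesis by (simp add: Bernstein_def algebra_simps)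
qed (auto simp: Bernstein_def algebra_simps not_le)

lemma solution_eq:
  "solution \<alpha> x n k = (\<Sum>j\<le>n. of_real (Bernstein n j \<alpha>) * x (k - int j))"
proof (induction n arbitrary: k)
  case 0
  then show ?case by (simp add: Bernstein_def)
next
  case (Suc n)
  \<comment> \<open>Since \<open>Bernstein n (Suc n) \<alpha> = 0\<close>, the sum may run to
    \<open>Suc n\<close>; splitting off \<open>j = 0\<close> then aligns it with Pascal's
    rule.\<close>
  have *: "(\<Sum>j\<le>n. of_real (Bernstein n j \<alpha>) * x (k - int j))
      = of_real (Bernstein n 0 \<alpha>) * x k
        + (\<Sum>j\<le>n. of_real (Bernstein n (Suc j) \<alpha>) * x (k - 1 - int j))"
  proof -
    have "(\<Sum>j\<le>n. of_real (Bernstein n j \<alpha>) * x (k - int j))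
        = (\<Sum>j\<le>Suc n. of_real (Bernstein n j \<alpha>) * x (k - int j))"
      by (simp add: Bernstein_def)
    then show ?thesis by (simp only: sum.atMost_Suc_shift) (simp add: algebra_simps)
  qed
  have B0: "Bernstein (Suc n) 0 \<alpha> = (1 - \<alpha>) * Bernstein n 0 \<alpha>"
    by (simp add: Bernstein_def)
  have "(\<Sum>j\<le>Suc n. of_real (Bernstein (Suc n) j \<alpha>) * x (k - int j))
      = of_real (Bernstein (Suc n) 0 \<alpha>) * x k
        + (\<Sum>j\<le>n. of_real (Bernstein (Suc n) (Suc j) \<alpha>) * x (k - 1 - int j))"
    by (simp only: sum.atMost_Suc_shift) (simp add: algebra_simps)
  also have "\<dots> = of_real (1 - \<alpha>) * (\<Sum>j\<le>n. of_real (Bernstein n j \<alpha>) * x (k - int j))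
        + of_real \<alpha> * (\<Sum>j\<le>n. of_real (Bernstein n j \<alpha>) * x (k - 1 - int j))"
    unfolding * Bernstein_Suc_Suc B0
    by (simp add: sum_distrib_left sum.distrib sum_subtractf algebra_simps)
  finally show ?case by (simp add: Suc.IH)
qed

text \<open>The case split stands for a weight 0 at index -1, which \<open>j - 1\<close> on naturals
  cannot express. At \<open>j = Suc n\<close> the value is \<open>- Bernstein n n a\<close>, so the
  natural index range is \<open>{..Suc n}\<close>.\<close>

definition Bernstein_diff :: "nat \<Rightarrow> nat \<Rightarrow> real \<Rightarrow> real" where
  "Bernstein_diff n j a = Bernstein n j a - (if j = 0 then 0 else Bernstein n (j - 1) a)"

text \<open>The absorption identities make \<open>Bernstein n j a\<close> and
  \<open>Bernstein n (j - 1) a\<close> multiples of the same \<open>Bernstein (Suc n) j a\<close>;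
  subtracting leaves the deviation of \<open>j\<close> from the mean as a factor.\<close>

lemma Bernstein_diff_eq:
  assumes "0 < a" "a < 1" "j \<le> Suc n"
  shows "Bernstein_diff n j a
    = Bernstein (Suc n) j a * (real (Suc n) * a - real j) / (real (Suc n) * a * (1 - a))"
proof -
  have 1: "real (Suc n) * (1 - a) * Bernstein n j a = (real (Suc n) - real j) * Bernstein (Suc n) j a"
  proof (cases "j \<le> n")
    case True
    have "real (Suc n - j) * real (Suc n choose j) = real (Suc n) * real (n choose j)"
      using binomial_absorb_comp[of "Suc n" j] by (metis diff_Suc_1 of_nat_mult)
    moreover have "real (Suc n - j) = real (Suc n) - real j" using True by simp
    moreover have "(1 - a) ^ (Suc n - j) = (1 - a) * (1 - a) ^ (n - j)"
      using True by (simp add: Suc_diff_le)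
    ultimately have "(real (Suc n) - real j) * Bernstein (Suc n) j a
        = (real (Suc n) * real (n choose j)) * (a ^ j * ((1 - a) * (1 - a) ^ (n - j)))"
      unfolding Bernstein_def by (metis mult.assoc)
    then show ?thesis unfolding Bernstein_def by (simp only: mult_ac)
  next
    case False
    then show ?thesis using assms(3) by (simp add: Bernstein_def not_le le_Suc_eq)
  qed
  have 2: "real (Suc n) * a * (if j = 0 then 0 else Bernstein n (j - 1) a) = real j * Bernstein (Suc n) j a"
  proof (cases j)
    case (Suc i)
    have "real (Suc i) * real (Suc n choose Suc i) = real (Suc n) * real (n choose i)"
      using Suc_times_binomial_eq[of n i] by (metis mult.commute of_nat_mult)
    then show ?thesis
      unfolding Bernstein_def Suc by simp
  qed simp
  have "Bernstein_diff n j a * (real (Suc n) * a * (1 - a))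
      = a * (real (Suc n) * (1 - a) * Bernstein n j a)
        - (1 - a) * (real (Suc n) * a * (if j = 0 then 0 else Bernstein n (j - 1) a))"
    unfolding Bernstein_diff_def by (simp only: algebra_simps)
  also have "\<dots> = Bernstein (Suc n) j a * (real (Suc n) * a - real j)"
    unfolding 1 2 by (simp add: algebra_simps)
  finally show ?thesis using assms by (simp add: nonzero_eq_divide_eq)
qed

lemma sum_Bernstein_variance:
  "(\<Sum>j\<le>m. Bernstein m j a * (real m * a - real j)\<^sup>2) = real m * a * (1 - a)"
proof -
  have "(\<Sum>j\<le>m. Bernstein m j a * (real m * a - real j)\<^sup>2)
      = (\<Sum>j\<le>m. real j * (real j - 1) * Bernstein m j a
          + (1 - 2 * (real m * a)) * (real j * Bernstein m j a) + (real m * a)\<^sup>2 * Bernstein m j a)"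
    by (intro sum.cong) (auto simp: power2_eq_square algebra_simps)
  also have "\<dots> = real m * a * (1 - a)"
    by (simp add: sum.distrib flip: sum_distrib_left) (simp add: power2_eq_square algebra_simps)
  finally show ?thesis .
qed

text \<open>The absolute first moment is estimated by the variance through \<open>2 \<bar>d\<bar> \<le> d\<^sup>2 / s + s\<close>
  with \<open>s\<close> the standard deviation.\<close>

lemma sum_abs_Bernstein_diff:
  assumes "0 < a" "a < 1"
  shows "(\<Sum>j\<le>Suc n. \<bar>Bernstein_diff n j a\<bar>) \<le> 1 / sqrt (real (Suc n) * a * (1 - a))"
proof -
  define v s where "v = real (Suc n) * a * (1 - a)" and "s = sqrt v"
  have v: "v > 0" using assms by (auto simp: v_def intro!: mult_pos_pos)
  then have s: "s > 0" "s * s = v" by (auto simp: s_def)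
  have am: "\<bar>d\<bar> \<le> (d\<^sup>2 / s + s) / 2" for d
  proof -
    have "0 \<le> (\<bar>d\<bar> - s)\<^sup>2" by simp
    then have "2 * \<bar>d\<bar> * s \<le> d\<^sup>2 + s * s" by (simp add: power2_eq_square algebra_simps)
    then show ?thesis using s by (simp add: field_simps)
  qed
  have eq: "(\<Sum>j\<le>Suc n. \<bar>Bernstein_diff n j a\<bar>)
      = (\<Sum>j\<le>Suc n. Bernstein (Suc n) j a * \<bar>real (Suc n) * a - real j\<bar>) / v"
    unfolding sum_divide_distrib
  proof (rule sum.cong)
    fix j assume "j \<in> {..Suc n}"
    then show "\<bar>Bernstein_diff n j a\<bar> = Bernstein (Suc n) j a * \<bar>real (Suc n) * a - real j\<bar> / v"
      using assms v Bernstein_nonneg[of a "Suc n" j] Bernstein_diff_eq[of a j n]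
      by (simp only: v_def atMost_iff) (simp add: abs_mult abs_divide)
  qed simp
  have "(\<Sum>j\<le>Suc n. Bernstein (Suc n) j a * \<bar>real (Suc n) * a - real j\<bar>)
      \<le> (\<Sum>j\<le>Suc n. Bernstein (Suc n) j a * (((real (Suc n) * a - real j)\<^sup>2 / s + s) / 2))"
    using assms by (intro sum_mono mult_left_mono am Bernstein_nonneg) auto
  also have "\<dots> = (\<Sum>j\<le>Suc n. 1 / (2 * s) * (Bernstein (Suc n) j a * (real (Suc n) * a - real j)\<^sup>2)
      + s / 2 * Bernstein (Suc n) j a)"
    by (intro sum.cong) (auto simp: field_simps)
  also have "\<dots> = 1 / (2 * s) * v + s / 2"
    unfolding sum.distrib sum_distrib_left[symmetric] sum_Bernstein_variance sum_Bernstein v_def by simp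
  also have "\<dots> = s" using s by (simp add: field_simps)
  finally have "(\<Sum>j\<le>Suc n. \<bar>Bernstein_diff n j a\<bar>) \<le> s / v"
    unfolding eq using v by (intro divide_right_mono) auto
  also have "s / v = 1 / s" using s v by (simp add: field_simps)
  finally show ?thesis by (simp only: s_def v_def)
qed

text \<open>Abel summation without boundary terms, because the weights extend by zero to the indices
  -1 and \<open>Suc n\<close>.\<close>

lemma Bernstein_summation_by_parts:
  fixes f :: "nat \<Rightarrow> complex"
  shows "(\<Sum>j\<le>n. of_real (Bernstein n j a) * (f (Suc j) - f j))
    = (\<Sum>j\<le>Suc n. of_real (- Bernstein_diff n j a) * f j)"
proof -
  have "(\<Sum>j\<le>Suc n. of_real (if j = 0 then 0 else Bernstein n (j - 1) a) * f j)
      = (\<Sum>j\<le>n. of_real (Bernstein n j a) * f (Suc j))"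
    by (simp only: sum.atMost_Suc_shift) simp
  moreover have "(\<Sum>j\<le>Suc n. of_real (Bernstein n j a) * f j) = (\<Sum>j\<le>n. of_real (Bernstein n j a) * f j)"
    by (simp add: Bernstein_def)
  moreover have "(\<Sum>j\<le>Suc n. of_real (- Bernstein_diff n j a) * f j)
      = (\<Sum>j\<le>Suc n. of_real (if j = 0 then 0 else Bernstein n (j - 1) a) * f j)
        - (\<Sum>j\<le>Suc n. of_real (Bernstein n j a) * f j)"
    unfolding sum_subtractf[symmetric] Bernstein_diff_def by (intro sum.cong) (auto simp: algebra_simps)
  ultimately show ?thesis by (simp only: right_diff_distrib sum_subtractf)
qed

subsection \<open>Shift means and solutions\<close>

lemma right_shift_funpow: "(right_shift ^^ j) x = (\<lambda>k. x (k - int j))"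
  by (induction j) (auto simp: right_shift_def algebra_simps)

lemma shift_mean_eq: "shift_mean x n = (\<lambda>k. \<Sum>j=1..n. (1 / of_nat n) * x (k - int j))"
  by (simp add: shift_mean_def right_shift_funpow sum_distrib_left)

lemma shift_mean_diff: "shift_mean (x - y) n = shift_mean x n - shift_mean y n"
  by (rule ext) (simp add: shift_mean_eq sum_subtractf diff_divide_distrib)

lemma shift_mean_const: "0 < n \<Longrightarrow> shift_mean (const_seq c) n = const_seq c"
  by (simp add: shift_mean_eq const_seq_def)

lemma solution_diff: "solution \<alpha> (x - y) n = solution \<alpha> x n - solution \<alpha> y n"
  by (rule ext) (simp add: solution_eq sum_subtractf right_diff_distrib)

lemma solution_const: "solution \<alpha> (const_seq c) n = const_seq c"
  by (induction n) (auto simp: const_seq_def algebra_simps)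

lemma solution_fixed: "x = (\<lambda>k. of_real (1 - \<alpha>) * x k + of_real \<alpha> * x (k - 1)) \<Longrightarrow> \<alpha> \<noteq> 0 \<Longrightarrow> x = const_seq (x 0)"
proof -
  assume x: "x = (\<lambda>k. of_real (1 - \<alpha>) * x k + of_real \<alpha> * x (k - 1))" and a: "\<alpha> \<noteq> 0"
  have "x k = x (k - 1)" for k
    using fun_cong[OF x, of k] a by (simp add: algebra_simps)
  then have *: "x k = x (k + 1)" for k by (metis add_diff_cancel_right')
  have "x k = x 0" for k
    by (induction k rule: int_induct[of _ 0]) (use * in \<open>auto simp: algebra_simps\<close>, metis diff_add_cancel)
  then show ?thesis by (auto simp: const_seq_def)
qed

definition coboundary :: "(int \<Rightarrow> complex) \<Rightarrow> int \<Rightarrow> complex" where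
  "coboundary u = u - right_shift u"

lemma bigo_tendsto_0:
  fixes f g :: "nat \<Rightarrow> real"
  assumes "f \<in> O(g)" "g \<longlonglongrightarrow> 0"
  shows "f \<longlonglongrightarrow> 0"
proof -
  have "g \<in> o(\<lambda>_. 1)" using assms(2) by (intro smalloI_tendsto) auto
  with assms(1) have "f \<in> o(\<lambda>_. 1)" by (rule landau_o.big_small_trans)
  then show ?thesis using smalloD_tendsto by fastforce
qed

section \<open>Contractivity and the rates in (b) and (c)\<close>

locale lp_averaging = lp_exponent +
  fixes \<alpha> :: real
  assumes \<alpha>: "0 < \<alpha>" "\<alpha> < 1"
begin

text \<open>The reciprocal of the standard deviation of a binomial variable with
  \<open>n + 1\<close> trials, which bounds the total variation of the weights.\<close>

definition rate :: "nat \<Rightarrow> real" where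
  "rate n = 1 / sqrt (real (Suc n) * \<alpha> * (1 - \<alpha>))"

lemma rate_nonneg: "0 \<le> rate n"
  using \<alpha> by (simp add: rate_def)

lemma rate_bigo: "rate \<in> O(\<lambda>n. real n powr (- 1 / 2))"
proof (rule bigoI)
  show "\<forall>\<^sub>F n in sequentially. norm (rate n)
      \<le> 1 / sqrt (\<alpha> * (1 - \<alpha>)) * norm (real n powr (- 1 / 2))"
    using eventually_gt_at_top[of 0]
  proof eventually_elim
    case (elim n)
    have "sqrt (\<alpha> * (1 - \<alpha>)) * sqrt (real n) \<le> sqrt (real (Suc n) * \<alpha> * (1 - \<alpha>))"
      using \<alpha> by (simp add: mult.assoc mult_right_mono flip: real_sqrt_mult)
    moreover have "0 < sqrt (\<alpha> * (1 - \<alpha>)) * sqrt (real n)" using \<alpha> elim by simp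
    ultimately have "rate n \<le> 1 / (sqrt (\<alpha> * (1 - \<alpha>)) * sqrt (real n))"
      unfolding rate_def by (rule frac_le[OF zero_le_one order_refl, rotated])
    moreover have "real n powr (- 1 / 2) = 1 / sqrt (real n)"
      using powr_minus_divide[of "real n" "1 / 2"] by (simp add: powr_half_sqrt)
    ultimately show ?case
      using rate_nonneg[of n] by simp
  qed
qed

lemma rate_tendsto_0: "rate \<longlonglongrightarrow> 0"
proof -
  have "(\<lambda>n. real n powr (- 1 / 2)) \<longlonglongrightarrow> 0"
    by (rule tendsto_neg_powr) (auto simp: filterlim_real_sequentially)
  with rate_bigo show ?thesis
    by (rule bigo_tendsto_0)
qed

lemma right_shift_lp: "x \<in> lp p \<Longrightarrow> right_shift x \<in> lp p"
  using lp_translate(1)[of x 1] by (simp add: right_shift_def)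

lemma coboundary_lp: "x \<in> lp p \<Longrightarrow> coboundary x \<in> lp p"
  by (simp add: coboundary_def lp_diff right_shift_lp)

text \<open>The weights are nonnegative with sum 1 and translation is isometric.\<close>

lemma solution_bound:
  assumes "x \<in> lp p"
  shows "solution \<alpha> x n \<in> lp p" "lp_norm p (solution \<alpha> x n) \<le> lp_norm p x"
proof -
  have "(\<Sum>j\<le>n. norm (of_real (Bernstein n j \<alpha>) :: complex) * lp_norm p (\<lambda>k. x (k - int j)))
      = lp_norm p x"
    using \<alpha> by (simp add: lp_translate(2)[OF assms] Bernstein_nonneg flip: sum_distrib_right)
  then show "solution \<alpha> x n \<in> lp p" "lp_norm p (solution \<alpha> x n) \<le> lp_norm p x"
    using lp_lincomb[of "{..n}" "\<lambda>j k. x (k - int j)" "\<lambda>j. of_real (Bernstein n j \<alpha>)"]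
      lp_translate(1)[OF assms]
    by (auto simp: solution_eq[abs_def])
qed

lemma shift_mean_bound:
  assumes "x \<in> lp p"
  shows "shift_mean x n \<in> lp p" "lp_norm p (shift_mean x n) \<le> lp_norm p x"
proof -
  \<comment> \<open>Only an inequality, because the sum is empty for \<open>n = 0\<close>.\<close>
  have "(\<Sum>j=1..n. norm (1 / of_nat n :: complex) * lp_norm p (\<lambda>k. x (k - int j))) \<le> lp_norm p x"
    using lp_norm_nonneg[OF assms] by (simp add: lp_translate(2)[OF assms] norm_divide)
  then show "shift_mean x n \<in> lp p" "lp_norm p (shift_mean x n) \<le> lp_norm p x"
    using lp_lincomb[of "{1..n}" "\<lambda>j k. x (k - int j)" "\<lambda>j. 1 / of_nat n"]
      lp_translate(1)[OF assms]
    by (auto simp: shift_mean_eq)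
qed

text \<open>The source of both upper rates: averaging the increments of a bounded family
  \<open>f\<close> is the same as pairing \<open>f\<close> with the small differences of the
  weights. For (c) the family consists of translates, for (b) of unnormalised Cesaro sums.\<close>

lemma Bernstein_diff_lincomb:
  assumes "\<And>j. j \<le> Suc n \<Longrightarrow> f j \<in> lp p" "\<And>j. j \<le> Suc n \<Longrightarrow> lp_norm p (f j) \<le> C"
  shows "lp_norm p (\<lambda>k. \<Sum>j\<le>n. of_real (Bernstein n j \<alpha>) * (f (Suc j) k - f j k)) \<le> rate n * C"
proof -
  have C: "0 \<le> C" using assms lp_norm_nonneg[of "f 0"] by force
  have "lp_norm p (\<lambda>k. \<Sum>j\<le>Suc n. of_real (- Bernstein_diff n j \<alpha>) * f j k)
      \<le> (\<Sum>j\<le>Suc n. norm (of_real (- Bernstein_diff n j \<alpha>) :: complex) * lp_norm p (f j))"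
    using lp_lincomb[of "{..Suc n}" f "\<lambda>j. of_real (- Bernstein_diff n j \<alpha>)"] assms(1) by blast
  also have "\<dots> \<le> (\<Sum>j\<le>Suc n. \<bar>Bernstein_diff n j \<alpha>\<bar> * C)"
    unfolding norm_of_real abs_minus_cancel by (intro sum_mono mult_left_mono assms(2)) auto
  also have "\<dots> \<le> rate n * C"
    unfolding sum_distrib_right[symmetric] rate_def
    by (intro mult_right_mono sum_abs_Bernstein_diff \<alpha> C)
  finally show ?thesis
    using Bernstein_summation_by_parts[of n \<alpha> "\<lambda>j. f j k" for k] by simp
qed

lemma solution_coboundary_bound:
  assumes "u \<in> lp p"
  shows "lp_norm p (solution \<alpha> (coboundary u) n) \<le> rate n * lp_norm p u"
proof -
  \<comment> \<open>\<open>S^j (u - S u)\<close> is minus the increment from \<open>S^j u\<close> to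
    \<open>S^(j+1) u\<close>, whence the factor -1.\<close>
  have "solution \<alpha> (coboundary u) n
      = (\<lambda>k. (-1) * (\<Sum>j\<le>n. of_real (Bernstein n j \<alpha>) * (u (k - int (Suc j)) - u (k - int j))))"
    unfolding sum_distrib_left
    by (rule ext) (auto simp: solution_eq coboundary_def right_shift_def algebra_simps intro!: sum.cong)
  moreover have "(\<lambda>k. \<Sum>j\<le>n. of_real (Bernstein n j \<alpha>) * (u (k - int (Suc j)) - u (k - int j))) \<in> lp p"
    using lp_lincomb[of "{..n}" "\<lambda>j k. u (k - int (Suc j)) - u (k - int j)"]
      lp_diff(1)[OF lp_translate(1) lp_translate(1), OF assms assms]
    by (auto simp: fun_diff_def)
  ultimately have "lp_norm p (solution \<alpha> (coboundary u) n)
      = lp_norm p (\<lambda>k. \<Sum>j\<le>n. of_real (Bernstein n j \<alpha>) * (u (k - int (Suc j)) - u (k - int j)))"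
    by (simp only: lp_scale(2)) simp
  also have "\<dots> \<le> rate n * lp_norm p u"
    by (rule Bernstein_diff_lincomb) (simp_all only: lp_translate[OF assms] order_refl)
  finally show ?thesis .
qed

lemma solution_right_shift: "solution \<alpha> (right_shift x) n = right_shift (solution \<alpha> x n)"
  by (rule ext) (simp add: solution_eq right_shift_def algebra_simps)

text \<open>\<open>T - I = - \<alpha> (I - S)\<close>, and \<open>T^n\<close> commutes with
  \<open>S\<close>. Hence (c) and its optimality are statements about solutions that start at a
  coboundary.\<close>

lemma solution_step:
  "solution \<alpha> x (n + 1) - solution \<alpha> x n = (\<lambda>k. of_real (- \<alpha>) * solution \<alpha> (coboundary x) n k)"
  by (rule ext) (simp add: coboundary_def solution_diff solution_right_shift,
      simp add: right_shift_def algebra_simps)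

lemma solution_step_norm:
  assumes "x \<in> lp p"
  shows "lp_norm p (solution \<alpha> x (n + 1) - solution \<alpha> x n)
    = \<alpha> * lp_norm p (solution \<alpha> (coboundary x) n)"
  unfolding solution_step
  using lp_scale(2)[OF solution_bound(1)[OF coboundary_lp[OF assms]], of "of_real (- \<alpha>)"] \<alpha>
  by simp

lemma solution_step_bigo:
  assumes "x \<in> lp p"
  shows "(\<lambda>n. lp_norm p (solution \<alpha> x (n + 1) - solution \<alpha> x n)) \<in> O(\<lambda>n. real n powr (- 1 / 2))"
proof (rule landau_o.big_trans[OF _ rate_bigo])
  have "norm (\<alpha> * lp_norm p (solution \<alpha> (coboundary x) n)) \<le> \<alpha> * lp_norm p x * norm (rate n)" for n
    using \<alpha> solution_coboundary_bound[OF assms, of n] rate_nonneg[of n]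
      lp_norm_nonneg[OF solution_bound(1)[OF coboundary_lp[OF assms]]]
    by (simp add: abs_mult mult.commute mult.left_commute mult_left_mono)
  then show "(\<lambda>n. lp_norm p (solution \<alpha> x (n + 1) - solution \<alpha> x n)) \<in> O(rate)"
    unfolding solution_step_norm[OF assms] by (intro bigoI[where c="\<alpha> * lp_norm p x"] always_eventually allI)
qed

text \<open>The hypothesis says that the sums \<open>A n = S w + ... + S^n w\<close> are bounded. As
  \<open>A (j + 1) - A j = S^(j+1) w\<close>, the sequence \<open>S T^n w\<close> averages
  increments of a bounded family.\<close>

lemma solution_bigo:
  assumes w: "w \<in> lp p" and O: "(\<lambda>n. lp_norm p (shift_mean w n)) \<in> O(\<lambda>n. 1 / real n)"
  shows "(\<lambda>n. lp_norm p (solution \<alpha> w n)) \<in> O(\<lambda>n. real n powr (- 1 / 2))"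
proof -
  define A where "A n = (\<lambda>k. \<Sum>j=1..n. 1 * w (k - int j))" for n
  have A_lp: "A n \<in> lp p" for n
    using lp_lincomb[of "{1..n}" "\<lambda>j k. w (k - int j)" "\<lambda>_. 1"] lp_translate(1)[OF w]
    by (simp add: A_def)
  have A_mean: "lp_norm p (A n) = real n * lp_norm p (shift_mean w n)" if "n > 0" for n
  proof -
    have "A n = (\<lambda>k. of_nat n * shift_mean w n k)"
      using that by (simp add: A_def shift_mean_eq sum_distrib_left)
    then show ?thesis using lp_scale(2)[OF shift_mean_bound(1)[OF w], of "of_nat n"] by simp
  qed
  obtain c where c: "\<forall>\<^sub>F n in sequentially. norm (lp_norm p (shift_mean w n)) \<le> c * norm (1 / real n)"
    using O by (auto elim: landau_o.bigE)
  obtain N where N: "\<And>n. n \<ge> N \<Longrightarrow> lp_norm p (shift_mean w n) \<le> c / real n"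
    using c unfolding eventually_sequentially by (auto intro: order_trans[OF abs_ge_self])
  \<comment> \<open>The bound by \<open>c\<close> holds from \<open>N\<close> on only; the maximum
    takes in the finitely many earlier sums.\<close>
  define C where "C = Max (insert c ((\<lambda>n. lp_norm p (A n)) ` {..N}))"
  have C: "lp_norm p (A n) \<le> C" for n
  proof (cases "n \<le> N")
    case True
    then show ?thesis unfolding C_def by (intro Max_ge) auto
  next
    case False
    then have "lp_norm p (A n) \<le> c" using N[of n] A_mean[of n] by (simp add: field_simps)
    also have "c \<le> C" unfolding C_def by (intro Max_ge) auto
    finally show ?thesis .
  qed
  have le: "lp_norm p (solution \<alpha> w n) \<le> rate n * C" for n
  proof -
    \<comment> \<open>The sums \<open>A n\<close> begin at \<open>j = 1\<close>, which costs one
      extra shift but does not change the norm.\<close>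
    have "lp_norm p (solution \<alpha> w n) = lp_norm p (\<lambda>k. solution \<alpha> w n (k - 1))"
      using lp_translate(2)[OF solution_bound(1)[OF w]] by simp
    also have "(\<lambda>k. solution \<alpha> w n (k - 1))
        = (\<lambda>k. \<Sum>j\<le>n. of_real (Bernstein n j \<alpha>) * (A (Suc j) k - A j k))"
      by (rule ext) (auto simp: solution_eq A_def algebra_simps intro!: sum.cong)
    also have "lp_norm p \<dots> \<le> rate n * C"
      by (rule Bernstein_diff_lincomb) (rule A_lp C)+
    finally show ?thesis .
  qed
  have "(\<lambda>n. lp_norm p (solution \<alpha> w n)) \<in> O(rate)"
    by (intro bigoI[where c=C] always_eventually allI)
      (use le rate_nonneg lp_norm_nonneg[OF solution_bound(1)[OF w]] in \<open>simp add: mult.commute\<close>)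
  then show ?thesis by (rule landau_o.big_trans[OF _ rate_bigo])
qed

section \<open>Convergence to zero and the closure of the coboundaries\<close>

definition almost_coboundary :: "(int \<Rightarrow> complex) \<Rightarrow> bool" where
  "almost_coboundary w \<longleftrightarrow> (\<forall>e>0. \<exists>u\<in>lp p. lp_norm p (w - coboundary u) \<le> e)"

text \<open>Here \<open>T n\<close> is an average of \<open>w\<close>, and the coboundaries
  \<open>w - T n\<close> themselves approximate \<open>w\<close>. The case \<open>n = 0\<close> is
  left out because the Cesaro mean is then the zero sequence.\<close>

lemma almost_coboundaryI:
  assumes "(\<lambda>n. lp_norm p (T n)) \<longlonglongrightarrow> 0"
    and "\<And>n. n > 0 \<Longrightarrow> \<exists>u\<in>lp p. w - T n = coboundary u"
  shows "almost_coboundary w"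
  unfolding almost_coboundary_def
proof (intro allI impI)
  fix e :: real assume "e > 0"
  then have "\<forall>\<^sub>F n in sequentially. lp_norm p (T n) < e \<and> 0 < n"
    using order_tendstoD(2)[OF assms(1)] eventually_gt_at_top[of "0::nat"] by (auto intro: eventually_conj)
  then obtain n where n: "lp_norm p (T n) < e" "0 < n"
    by (auto simp: eventually_sequentially)
  then obtain u where u: "u \<in> lp p" "w - T n = coboundary u" using assms(2) by blast
  have "w - coboundary u = T n" unfolding u(2)[symmetric] by (simp add: fun_eq_iff)
  then show "\<exists>u\<in>lp p. lp_norm p (w - coboundary u) \<le> e"
    using u(1) less_imp_le[OF n(1)] by (metis (no_types))
qed

text \<open>The vectors on which additive contractions tend to 0 form a closed set. The dense
  families tested below are the coboundaries and the finitely supported sequences.\<close>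

lemma contractions_tendsto_0:
  assumes w: "w \<in> lp p"
    and T: "\<And>n x y. T n (x - y) = T n x - T n y"
      "\<And>n x. x \<in> lp p \<Longrightarrow> T n x \<in> lp p" "\<And>n x. x \<in> lp p \<Longrightarrow> lp_norm p (T n x) \<le> lp_norm p x"
    and approx: "\<And>e. e > 0 \<Longrightarrow>
      \<exists>v\<in>lp p. lp_norm p (w - v) \<le> e \<and> (\<lambda>n. lp_norm p (T n v)) \<longlonglongrightarrow> 0"
  shows "(\<lambda>n. lp_norm p (T n w)) \<longlonglongrightarrow> 0"
proof (rule LIMSEQ_I)
  fix e :: real assume e: "e > 0"
  then obtain v where v: "v \<in> lp p" "lp_norm p (w - v) \<le> e / 2" "(\<lambda>n. lp_norm p (T n v)) \<longlonglongrightarrow> 0"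
    using approx by (meson half_gt_zero)
  obtain N where N: "\<And>n. n \<ge> N \<Longrightarrow> lp_norm p (T n v) < e / 2"
    using order_tendstoD(2)[OF v(3), of "e / 2"] e by (auto simp: eventually_sequentially)
  have "lp_norm p (T n w) < e" if "n \<ge> N" for n
  proof -
    have "T n w = (\<lambda>k. T n (w - v) k + T n v k)"
      unfolding T(1) by (simp add: fun_eq_iff)
    then have "lp_norm p (T n w) \<le> lp_norm p (T n (w - v)) + lp_norm p (T n v)"
      using lp_add(2) T(2) lp_diff(1) w v(1) by metis
    also have "\<dots> < e"
      using T(3)[OF lp_diff(1)[OF w v(1)], of n] v(2) N[OF that] by linarith
    finally show ?thesis .
  qed
  then show "\<exists>N. \<forall>n\<ge>N. norm (lp_norm p (T n w) - 0) < e"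
    using lp_norm_nonneg T(2) w by auto
qed

text \<open>\<open>I - S^j = (I - S) (I + S + ... + S^(j-1))\<close>.\<close>

lemma translate_diff_coboundary:
  assumes "w \<in> lp p"
  shows "\<exists>u\<in>lp p. w - (\<lambda>k. w (k - int j)) = coboundary u"
proof -
  define u where "u = (\<lambda>k. \<Sum>i<j. 1 * w (k - int i))"
  have "u \<in> lp p"
    using lp_lincomb[of "{..<j}" "\<lambda>j k. w (k - int j)" "\<lambda>_. 1"] lp_translate(1)[OF assms]
    by (simp add: u_def)
  moreover have "w k - w (k - int j) = (\<Sum>i<j. w (k - int i) - w (k - int (Suc i)))" for k
    using sum_lessThan_telescope'[of "\<lambda>i. w (k - int i)" j] by simp
  then have "w - (\<lambda>k. w (k - int j)) = coboundary u"
    by (simp add: fun_eq_iff coboundary_def u_def right_shift_def sum_subtractf algebra_simps)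
  ultimately show ?thesis by blast
qed

text \<open>\<open>w\<close> minus its Cesaro mean is the average of the coboundaries
  \<open>w - S^j w\<close>.\<close>

lemma shift_mean_almost_coboundary:
  assumes w: "w \<in> lp p" "(\<lambda>n. lp_norm p (shift_mean w n)) \<longlonglongrightarrow> 0"
  shows "almost_coboundary w"
proof (rule almost_coboundaryI[OF w(2)])
  fix n :: nat assume n: "n > 0"
  obtain u where u: "\<And>j. u j \<in> lp p" "\<And>j. w - (\<lambda>k. w (k - int j)) = coboundary (u j)"
    using translate_diff_coboundary[OF w(1)] by metis
  define v where "v = (\<lambda>k. \<Sum>j=1..n. (1 / of_nat n) * u j k)"
  have "v \<in> lp p" using lp_lincomb[of "{1..n}" u "\<lambda>_. 1 / of_nat n"] u(1) by (simp add: v_def)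
  moreover have "w - shift_mean w n = coboundary v"
  proof
    fix k
    have "(w - shift_mean w n) k = (\<Sum>j=1..n. (1 / of_nat n) * (w k - w (k - int j)))"
      using n by (simp add: shift_mean_eq right_diff_distrib sum_subtractf)
    also have "\<dots> = (\<Sum>j=1..n. (1 / of_nat n) * (u j k - u j (k - 1)))"
      using fun_cong[OF u(2), where x=k] by (simp add: coboundary_def right_shift_def)
    also have "\<dots> = coboundary v k"
      by (simp add: v_def coboundary_def right_shift_def right_diff_distrib sum_subtractf)
    finally show "(w - shift_mean w n) k = coboundary v k" .
  qed
  ultimately show "\<exists>u\<in>lp p. w - shift_mean w n = coboundary u" by blast
qed

text \<open>\<open>I - T^(n+1) = (I - T^n) + \<alpha> (I - S) T^n\<close>, so by induction
  \<open>I - S\<close> divides \<open>I - T^n\<close>.\<close>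

lemma solution_almost_coboundary:
  assumes w: "w \<in> lp p" "(\<lambda>n. lp_norm p (solution \<alpha> w n)) \<longlonglongrightarrow> 0"
  shows "almost_coboundary w"
proof (rule almost_coboundaryI[OF w(2)])
  fix n :: nat
  show "\<exists>u\<in>lp p. w - solution \<alpha> w n = coboundary u"
  proof (induction n)
    case 0
    then show ?case using lp_zero(1) by (intro bexI[of _ "\<lambda>k. 0"]) (auto simp: coboundary_def right_shift_def fun_eq_iff)
  next
    case (Suc n)
    then obtain u where u: "u \<in> lp p" "w - solution \<alpha> w n = coboundary u" by blast
    have "w - solution \<alpha> w (Suc n) = coboundary (\<lambda>k. u k + of_real \<alpha> * solution \<alpha> w n k)"
    proof
      fix k
      have "w k = solution \<alpha> w n k + u k - u (k - 1)"
        using fun_cong[OF u(2), of k] by (simp add: coboundary_def right_shift_def algebra_simps)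
      then show "(w - solution \<alpha> w (Suc n)) k = coboundary (\<lambda>k. u k + of_real \<alpha> * solution \<alpha> w n k) k"
        by (simp add: coboundary_def right_shift_def algebra_simps)
    qed
    then show ?case using lp_add(1)[OF u(1) lp_scale(1)[OF solution_bound(1)[OF w(1)]]] by blast
  qed
qed

text \<open>The mean telescopes to \<open>(S u - S^(n+1) u) / n\<close>. Coboundaries thus satisfy
  the hypothesis of (b), and its optimality can be tested on them.\<close>

lemma shift_mean_coboundary:
  assumes u: "u \<in> lp p"
  shows "(\<lambda>n. lp_norm p (shift_mean (coboundary u) n)) \<in> O(\<lambda>n. 1 / real n)"
    "(\<lambda>n. lp_norm p (shift_mean (coboundary u) n)) \<longlonglongrightarrow> 0"
proof -
  have le: "lp_norm p (shift_mean (coboundary u) n) \<le> 2 * lp_norm p u * (1 / real n)" for n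
  proof -
    have "shift_mean (coboundary u) n
        = (\<lambda>k. (1 / of_nat n) * ((\<lambda>k. u (k - 1)) - (\<lambda>k. u (k - int (Suc n)))) k)"
    proof
      fix k
      have "(\<Sum>j=1..n. u (k - int j) - u (k - int (Suc j))) = u (k - 1) - u (k - int (Suc n))"
        by (induction n) (auto simp: algebra_simps)
      moreover have "shift_mean (coboundary u) n k
          = (1 / of_nat n) * (\<Sum>j=1..n. u (k - int j) - u (k - int (Suc j)))"
        unfolding shift_mean_eq sum_distrib_left
        by (rule sum.cong) (simp_all add: coboundary_def right_shift_def diff_diff_eq add.commute)
      ultimately show "shift_mean (coboundary u) n k
        = (1 / of_nat n) * ((\<lambda>k. u (k - 1)) - (\<lambda>k. u (k - int (Suc n)))) k"
        by (simp only: minus_apply)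
    qed
    then have "lp_norm p (shift_mean (coboundary u) n)
        = 1 / real n * lp_norm p ((\<lambda>k. u (k - 1)) - (\<lambda>k. u (k - int (Suc n))))"
      by (simp only: lp_scale(2)[OF lp_diff(1)[OF lp_translate(1) lp_translate(1), OF u u]])
        (simp add: norm_divide)
    also have "\<dots> \<le> 1 / real n * (lp_norm p u + lp_norm p u)"
      using lp_diff(2)[OF lp_translate(1) lp_translate(1), OF u u, of 1 "int (Suc n)"]
      by (intro mult_left_mono) (auto simp only: lp_translate(2)[OF u] zero_le_divide_1_iff of_nat_0_le_iff)
    finally show ?thesis by (simp add: mult.commute)
  qed
  show O: "(\<lambda>n. lp_norm p (shift_mean (coboundary u) n)) \<in> O(\<lambda>n. 1 / real n)"
    using le lp_norm_nonneg[OF shift_mean_bound(1)[OF coboundary_lp[OF u]]]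
    by (intro bigoI[where c="2 * lp_norm p u"] always_eventually allI) auto
  show "(\<lambda>n. lp_norm p (shift_mean (coboundary u) n)) \<longlonglongrightarrow> 0"
    by (rule bigo_tendsto_0[OF O lim_1_over_n])
qed

text \<open>Either limit forces \<open>almost_coboundary w\<close>; conversely both families are
  contractions that tend to 0 on coboundaries.\<close>

lemma solution_tendsto_0_iff:
  assumes w: "w \<in> lp p"
  shows "(\<lambda>n. lp_norm p (solution \<alpha> w n)) \<longlonglongrightarrow> 0 \<longleftrightarrow> (\<lambda>n. lp_norm p (shift_mean w n)) \<longlonglongrightarrow> 0"
proof
  assume "(\<lambda>n. lp_norm p (solution \<alpha> w n)) \<longlonglongrightarrow> 0"
  then have "almost_coboundary w" using solution_almost_coboundary[OF w] by blast
  then show "(\<lambda>n. lp_norm p (shift_mean w n)) \<longlonglongrightarrow> 0"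
    unfolding almost_coboundary_def
    by (intro contractions_tendsto_0[where T="\<lambda>n x. shift_mean x n", OF w])
      (auto simp: shift_mean_diff shift_mean_bound dest!: spec intro: coboundary_lp shift_mean_coboundary)
next
  assume "(\<lambda>n. lp_norm p (shift_mean w n)) \<longlonglongrightarrow> 0"
  then have "almost_coboundary w" using shift_mean_almost_coboundary[OF w] by blast
  moreover have "(\<lambda>n. lp_norm p (solution \<alpha> (coboundary u) n)) \<longlonglongrightarrow> 0" if u: "u \<in> lp p" for u
    by (rule tendsto_sandwich[OF _ _ tendsto_const tendsto_mult_left_zero[OF rate_tendsto_0, of "lp_norm p u"]])
      (auto simp: solution_coboundary_bound[OF u] lp_norm_nonneg solution_bound coboundary_lp u)
  ultimately show "(\<lambda>n. lp_norm p (solution \<alpha> w n)) \<longlonglongrightarrow> 0"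
    unfolding almost_coboundary_def
    by (intro contractions_tendsto_0[where T="\<lambda>n x. solution \<alpha> x n", OF w])
      (auto simp: solution_diff solution_bound dest!: spec intro: coboundary_lp)
qed

end

subsection \<open>Gliding humps and truncation\<close>

text \<open>\<open>w\<close> is \<open>(1 / 2) ^ m\<close> at sparse positions \<open>g m\<close>
  where \<open>f\<close> is at most \<open>(1 / 4) ^ m\<close> in modulus, and 0 elsewhere. It
  supplies the block norms of the gliding hump.\<close>

lemma summable_not_bigo:
  fixes f :: "nat \<Rightarrow> real"
  assumes "f \<longlonglongrightarrow> 0"
  obtains w :: "nat \<Rightarrow> real" where "\<And>i. 0 \<le> w i" "\<And>i. w i \<le> 1" "summable w" "w \<notin> O(f)"
proof -
  have "\<exists>g. \<forall>m. \<bar>f (g m)\<bar> \<le> (1 / 4) ^ m \<and> g m < g (Suc m)"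
  proof (rule dependent_nat_choice)
    have ev: "\<forall>\<^sub>F i in sequentially. \<bar>f i\<bar> \<le> (1 / 4) ^ m" for m
      using tendstoD[OF assms, of "(1 / 4) ^ m"] by (auto elim: eventually_mono)
    show "\<exists>x. \<bar>f x\<bar> \<le> (1 / 4) ^ 0"
      using ev[of 0] by (auto simp: eventually_sequentially)
    fix x m
    show "\<exists>y. \<bar>f y\<bar> \<le> (1 / 4) ^ Suc m \<and> x < y"
      using eventually_happens[OF eventually_conj[OF ev[of "Suc m"] eventually_gt_at_top[of x]]] by auto
  qed
  then obtain g where g: "\<And>m. \<bar>f (g m)\<bar> \<le> (1 / 4) ^ m" "strict_mono g"
    by (auto simp: strict_mono_Suc_iff)
  define w where "w i = (if i \<in> range g then (1 / 2 :: real) ^ inv g i else 0)" for i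
  have wg: "w (g m) = (1 / 2) ^ m" for m
    using g(2) by (simp add: w_def strict_mono_imp_inj_on)
  show thesis
  proof
    show "0 \<le> w i" "w i \<le> 1" for i by (auto simp: w_def power_le_one)
    have "summable (\<lambda>m. w (g m))" unfolding wg by (rule summable_geometric) simp
    then show "summable w"
      by (subst (asm) summable_mono_reindex[OF g(2)]) (auto simp: w_def)
    show "w \<notin> O(f)"
    proof
      assume "w \<in> O(f)"
      then obtain c where c: "c > 0" "\<forall>\<^sub>F i in sequentially. norm (w i) \<le> c * norm (f i)"
        by (rule landau_o.bigE)
      have "\<forall>\<^sub>F m in sequentially. norm (w (g m)) \<le> c * norm (f (g m))"
        by (rule eventually_compose_filterlim[OF c(2) filterlim_subseq[OF g(2)]])
      then obtain M where M: "\<And>m. m \<ge> M \<Longrightarrow> norm (w (g m)) \<le> c * norm (f (g m))"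
        by (auto simp: eventually_sequentially)
      obtain m0 where "c < 2 ^ m0" using real_arch_pow[of 2 c] by auto
      then have m: "c < 2 ^ max m0 M"
        by (rule less_le_trans) (simp add: power_increasing)
      have "norm (w (g (max m0 M))) \<le> c * norm (f (g (max m0 M)))" by (rule M) simp
      also have "\<dots> \<le> c * (1 / 4) ^ max m0 M" using c g(1) by (intro mult_left_mono) auto
      finally have "(1 / 2 :: real) ^ max m0 M \<le> c * (1 / 4) ^ max m0 M" unfolding wg by simp
      also have "\<dots> < 2 ^ max m0 M * (1 / 4) ^ max m0 M"
        using m by (intro mult_strict_right_mono) auto
      also have "\<dots> = (1 / 2) ^ max m0 M" by (simp flip: power_mult_distrib)
      finally show False by simp
    qed
  qed
qed

text \<open>\<open>floor_log\<close> has the constant value \<open>i\<close> on the block from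
  \<open>2 ^ i\<close> to \<open>2 ^ (i + 1)\<close>, which has \<open>2 ^ i\<close>
  elements.\<close>

lemma sum_floor_log:
  fixes g :: "nat \<Rightarrow> real"
  shows "(\<Sum>k\<in>{1..<2 ^ N}. g (floor_log k)) = (\<Sum>i<N. 2 ^ i * g i)"
proof (induction N)
  case (Suc N)
  have "{1..<2 ^ Suc N} = {1..<2 ^ N} \<union> {2 ^ N..<2 ^ Suc N :: nat}"
    by (auto simp: not_less intro: order_trans[OF one_le_power])
  moreover have "(\<Sum>k\<in>{2 ^ N..<2 ^ Suc N}. g (floor_log k)) = (\<Sum>k\<in>{2 ^ N..<2 ^ Suc N :: nat}. g N)"
    by (intro sum.cong arg_cong[of _ _ g]) (auto intro!: floor_log_eqI)
  ultimately show ?case using Suc by (simp add: sum.union_disjoint)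
qed simp

text \<open>The modulus of the symbol of \<open>T\<close> on the unit circle. The deficit from 1 is
  quadratic in the distance of \<open>z\<close> from 1, so at distance
  \<open>n powr (- 1 / 2)\<close> the symbol survives \<open>n\<close> iterations.\<close>

lemma cmod_convex_comb_sq:
  fixes z :: complex
  assumes "norm z = 1"
  shows "(norm (of_real (1 - a) + of_real a * z))\<^sup>2 = 1 - a * (1 - a) * (norm (1 - z))\<^sup>2"
proof -
  have "(Re z)\<^sup>2 + (Im z)\<^sup>2 = 1" using assms by (metis cmod_power2 one_power2)
  then have "Im z * Im z = 1 - Re z * Re z" by (simp add: power2_eq_square)
  then have 1: "a * (Im z * Im z) = a * (1 - Re z * Re z)" and 2: "a * (a * (Im z * Im z)) = a * (a * (1 - Re z * Re z))"
    by simp_all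
  show ?thesis
    unfolding cmod_power2 using 1 2 by (simp add: power2_eq_square algebra_simps)
qed

lemma unit_at_distance:
  assumes "0 \<le> d" "d \<le> 2"
  obtains z :: complex where "norm z = 1" "norm (1 - z) = d"
proof
  \<comment> \<open>On the unit circle the squared distance from 1 is \<open>2 - 2 * Re z\<close>,
    which dictates the real part.\<close>
  define z where "z = Complex (1 - d\<^sup>2 / 2) (sqrt (1 - (1 - d\<^sup>2 / 2)\<^sup>2))"
  have "d\<^sup>2 \<le> 2\<^sup>2" using assms by (intro power_mono) auto
  then have "\<bar>1 - d\<^sup>2 / 2\<bar> \<le> 1" by (simp add: abs_le_iff)
  then have "(1 - d\<^sup>2 / 2)\<^sup>2 \<le> 1" by (simp add: abs_square_le_1)
  then have I: "(Im z)\<^sup>2 = 1 - (1 - d\<^sup>2 / 2)\<^sup>2" by (simp add: z_def)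
  show "norm z = 1" unfolding cmod_def I by (simp add: z_def)
  have "(norm (1 - z))\<^sup>2 = d\<^sup>2"
    unfolding cmod_power2 using I by (simp add: z_def power2_eq_square algebra_simps)
  then show "norm (1 - z) = d" using assms by (simp add: power2_eq_iff_nonneg)
qed

section \<open>Lower bounds and truncation for finite exponents\<close>

context lp_exponent
begin

text \<open>Chebyshev's inequality for the counting measure.\<close>

lemma lp_norm_ge_card:
  assumes "p \<noteq> \<infinity>" "x \<in> lp p" "finite F" "0 \<le> a" "\<And>k. k \<in> F \<Longrightarrow> a \<le> norm (x k)"
  shows "real (card F) * a powr q \<le> lp_norm p x powr q"
proof -
  have "real (card F) * a powr q = (\<Sum>k\<in>F. a powr q)" by simp
  also have "\<dots> \<le> (\<Sum>k\<in>F. norm (x k) powr q)"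
    using assms q_ge_1 by (intro sum_mono powr_mono2) auto
  also have "\<dots> \<le> lp_norm p x powr q"
    using lp_bound_norm[OF assms(2)] assms by (simp add: lp_bound_def)
  finally show ?thesis .
qed

lemma const_seq_in_lp_iff:
  assumes "p \<noteq> \<infinity>"
  shows "const_seq c \<in> lp p \<longleftrightarrow> c = 0"
proof
  assume c: "const_seq c \<in> lp p"
  show "c = 0"
  proof (rule ccontr)
    assume "c \<noteq> 0"
    then have pos: "norm c powr q > 0" by simp
    obtain N where N: "lp_norm p (const_seq c) powr q < real N * norm c powr q"
      using reals_Archimedean3[OF pos] by blast
    have "real (card {0..<int N}) * norm c powr q \<le> lp_norm p (const_seq c) powr q"
      by (rule lp_norm_ge_card[OF assms c]) (auto simp: const_seq_def)
    then show False using N by simp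
  qed
qed (use lp_zero in \<open>simp add: const_seq_def\<close>)

text \<open>The total \<open>S\<close> is the supremum of the finite sums, so some \<open>F\<close>
  misses it by less than \<open>e powr q\<close>; every finite set disjoint from \<open>F\<close>
  then carries at most that much.\<close>

lemma lp_truncate:
  assumes "p \<noteq> \<infinity>" "x \<in> lp p" "e > 0"
  obtains F where "finite F" "(\<lambda>k. if k \<in> F then x k else 0) \<in> lp p"
    "lp_norm p (x - (\<lambda>k. if k \<in> F then x k else 0)) \<le> e"
proof -
  have s: "(\<lambda>k. norm (x k) powr q) summable_on UNIV"
    using assms by (simp add: lp_def)
  define S where "S = (\<Sum>\<^sub>\<infinity>k. norm (x k) powr q)"
  obtain F where F: "finite F" "S - e powr q < (\<Sum>k\<in>F. norm (x k) powr q)"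
  proof (rule ccontr)
    assume "\<not> thesis"
    with that have "(\<Sum>k\<in>F. norm (x k) powr q) \<le> S - e powr q" if "finite F" for F
      using \<open>finite F\<close> by (meson not_le)
    then have "S \<le> S - e powr q"
      unfolding S_def by (intro infsum_le_finite_sums[OF s]) (auto simp: S_def)
    then show False using assms by (simp add: powr_nonneg_iff not_le)
  qed
  define y where "y = (\<lambda>k. if k \<in> F then x k else 0)"
  have "lp_bound p e (x - y)"
    unfolding lp_bound_def
  proof (simp add: assms(1), intro allI impI)
    fix G :: "int set" assume G: "finite G"
    have "(\<Sum>k\<in>G. norm (x k - y k) powr q) = (\<Sum>k\<in>G - F. norm (x k) powr q)"
      using G q_ge_1[OF assms(1)] by (intro sum.mono_neutral_cong_right) (auto simp: y_def)
    moreover have "(\<Sum>k\<in>F. norm (x k) powr q) + (\<Sum>k\<in>G - F. norm (x k) powr q) \<le> S"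
      unfolding S_def using F(1) G
      by (subst sum.union_disjoint[symmetric]) (auto intro!: finite_sum_le_infsum s)
    ultimately show "(\<Sum>k\<in>G. norm (x k - y k) powr q) \<le> e powr q" using F(2) by linarith
  qed
  then have "lp_norm p (x - y) \<le> e" using lp_norm_boundI assms(3) by simp
  moreover have "y \<in> lp p" by (rule lp_mono(1)[OF assms(2)]) (auto simp: y_def)
  ultimately show thesis using that F(1) unfolding y_def by blast
qed

end

section \<open>The exponents for which all initial data converge\<close>

context lp_averaging
begin

definition unit_seq :: "int \<Rightarrow> int \<Rightarrow> complex" where
  "unit_seq m k = (if k = m then 1 else 0)"

lemma shift_mean_unit_seq:
  "shift_mean (unit_seq m) n k = (if m + 1 \<le> k \<and> k \<le> m + int n then 1 / of_nat n else 0)"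
proof -
  have "(\<Sum>j=1..n. unit_seq m (k - int j)) = (\<Sum>j=1..n. if j = nat (k - m) \<and> m \<le> k then 1 else 0)"
    by (intro sum.cong) (auto simp: unit_seq_def)
  also have "\<dots> = (if m + 1 \<le> k \<and> k \<le> m + int n then 1 else 0)"
    by (cases "m \<le> k") auto
  finally show ?thesis
    unfolding shift_mean_eq sum_distrib_left[symmetric] by simp
qed

lemma unit_seq_lp: "unit_seq m \<in> lp p"
proof (rule lp_norm_boundI(1)[of 1])
  show "lp_bound p 1 (unit_seq m)"
    unfolding lp_bound_def
  proof (simp, intro conjI impI allI)
    show "norm (unit_seq m k) \<le> 1" for k by (simp add: unit_seq_def)
    fix F :: "int set" assume F: "finite F" and p: "p \<noteq> \<infinity>"
    have "(\<Sum>k\<in>F. norm (unit_seq m k) powr q) \<le> (\<Sum>k\<in>F. if k = m then 1 else 0)"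
      using q_ge_1[OF p] by (intro sum_mono) (auto simp: unit_seq_def)
    also have "\<dots> \<le> 1" using F by simp
    finally show "(\<Sum>k\<in>F. norm (unit_seq m k) powr q) \<le> 1" .
  qed
qed simp

text \<open>The mean has \<open>n\<close> entries of size \<open>1 / n\<close>. The resulting
  exponent \<open>1 / q - 1\<close> is negative for \<open>q > 1\<close> but zero for
  \<open>q = 1\<close>.\<close>

lemma shift_mean_unit_seq_bound:
  assumes "p \<noteq> \<infinity>" "n > 0"
  shows "lp_norm p (shift_mean (unit_seq m) n) \<le> real n powr (1 / q - 1)"
proof (rule lp_norm_boundI(2))
  have "(\<Sum>k\<in>F. norm (shift_mean (unit_seq m) n k) powr q) \<le> (real n powr (1 / q - 1)) powr q"
    if F: "finite F" for F
  proof -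
    have "(\<Sum>k\<in>F. norm (shift_mean (unit_seq m) n k) powr q)
        \<le> (\<Sum>k\<in>F. if k \<in> {m + 1..m + int n} then (1 / real n) powr q else 0)"
      by (intro sum_mono) (auto simp: shift_mean_unit_seq norm_divide)
    also have "\<dots> = real (card (F \<inter> {m + 1..m + int n})) * (1 / real n) powr q"
      using F by (simp add: sum.If_cases Int_def)
    also have "\<dots> \<le> real n * (1 / real n) powr q"
      using card_mono[of "{m + 1..m + int n}" "F \<inter> {m + 1..m + int n}"] by (intro mult_right_mono) auto
    also have "\<dots> = (real n powr (1 / q - 1)) powr q"
      using assms q_ge_1 by (simp add: powr_powr powr_divide powr_diff algebra_simps)
    finally show ?thesis .
  qed
  then show "lp_bound p (real n powr (1 / q - 1)) (shift_mean (unit_seq m) n)"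
    using assms by (simp add: lp_bound_def)
qed simp

lemma shift_mean_unit_seq_tendsto_0:
  assumes "1 < p" "p < \<infinity>"
  shows "(\<lambda>n. lp_norm p (shift_mean (unit_seq m) n)) \<longlonglongrightarrow> 0"
proof (rule tendsto_sandwich[OF _ _ tendsto_const])
  have p: "p \<noteq> \<infinity>" and q: "1 < q" using assms p_eq by auto (metis ereal_less(3) one_ereal_def less_ereal.simps(1))
  show "(\<lambda>n. real n powr (1 / q - 1)) \<longlonglongrightarrow> 0"
    using q by (intro tendsto_neg_powr) (auto simp: filterlim_real_sequentially field_simps)
  show "\<forall>\<^sub>F n in sequentially. lp_norm p (shift_mean (unit_seq m) n) \<le> real n powr (1 / q - 1)"
    using eventually_gt_at_top[of 0] by eventually_elim (rule shift_mean_unit_seq_bound[OF p])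
  show "\<forall>\<^sub>F n in sequentially. 0 \<le> lp_norm p (shift_mean (unit_seq m) n)"
    by (simp add: lp_norm_nonneg shift_mean_bound unit_seq_lp)
qed

text \<open>Truncation reduces the claim to finitely supported sequences, and linearity to unit
  sequences.\<close>

lemma shift_mean_tendsto_0:
  assumes "1 < p" "p < \<infinity>" "w \<in> lp p"
  shows "(\<lambda>n. lp_norm p (shift_mean w n)) \<longlonglongrightarrow> 0"
proof (rule contractions_tendsto_0[where T="\<lambda>n x. shift_mean x n", OF assms(3)])
  fix e :: real assume e: "e > 0"
  have p: "p \<noteq> \<infinity>" using assms by auto
  obtain F where F: "finite F" "(\<lambda>k. if k \<in> F then w k else 0) \<in> lp p"
      "lp_norm p (w - (\<lambda>k. if k \<in> F then w k else 0)) \<le> e"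
    using lp_truncate[OF p assms(3) e] .
  define v where "v = (\<lambda>k. if k \<in> F then w k else 0)"
  have v: "v = (\<lambda>k. \<Sum>m\<in>F. w m * unit_seq m k)"
    using F(1) by (simp add: v_def unit_seq_def mult_delta_right fun_eq_iff)
  have mean: "shift_mean v n = (\<lambda>k. \<Sum>m\<in>F. w m * shift_mean (unit_seq m) n k)" for n
    unfolding v shift_mean_eq
    by (rule ext, simp only: sum_distrib_left, subst sum.swap) (simp add: mult.left_commute)
  have "(\<lambda>n. lp_norm p (shift_mean v n)) \<longlonglongrightarrow> 0"
  proof (rule tendsto_sandwich[OF _ _ tendsto_const])
    show "(\<lambda>n. \<Sum>m\<in>F. norm (w m) * lp_norm p (shift_mean (unit_seq m) n)) \<longlonglongrightarrow> 0"
      by (intro tendsto_null_sum tendsto_mult_right_zero shift_mean_unit_seq_tendsto_0 assms)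
    show "\<forall>\<^sub>F n in sequentially. lp_norm p (shift_mean v n)
        \<le> (\<Sum>m\<in>F. norm (w m) * lp_norm p (shift_mean (unit_seq m) n))"
      unfolding mean using lp_lincomb[OF F(1) shift_mean_bound(1)[OF unit_seq_lp]] by simp
    show "\<forall>\<^sub>F n in sequentially. 0 \<le> lp_norm p (shift_mean v n)"
      using F(2) by (simp add: lp_norm_nonneg shift_mean_bound v_def)
  qed
  then show "\<exists>v\<in>lp p. lp_norm p (w - v) \<le> e \<and> (\<lambda>n. lp_norm p (shift_mean v n)) \<longlonglongrightarrow> 0"
    using F unfolding v_def by blast
qed (auto simp: shift_mean_diff shift_mean_bound)

text \<open>For \<open>p = 1\<close> averaging spreads the unit mass without losing any of
  it.\<close>

lemma shift_mean_unit_seq_not_tendsto_0: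
  assumes "p = 1"
  shows "\<not> (\<lambda>n. lp_norm p (shift_mean (unit_seq 0) n)) \<longlonglongrightarrow> 0"
proof
  assume lim: "(\<lambda>n. lp_norm p (shift_mean (unit_seq 0) n)) \<longlonglongrightarrow> 0"
  have "\<forall>\<^sub>F n in sequentially. 1 \<le> lp_norm p (shift_mean (unit_seq 0) n)"
    using eventually_gt_at_top[of 0]
  proof eventually_elim
    case (elim n)
    have "real (card {1..int n}) * (1 / real n) powr q \<le> lp_norm p (shift_mean (unit_seq 0) n) powr q"
      by (rule lp_norm_ge_card[OF _ shift_mean_bound(1)[OF unit_seq_lp]])
        (use assms in \<open>auto simp: shift_mean_unit_seq norm_divide\<close>)
    then show ?case using assms elim lp_norm_nonneg[OF shift_mean_bound(1)[OF unit_seq_lp]] by simp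
  qed
  then have "(1::real) \<le> 0" by (rule tendsto_lowerbound[OF lim]) simp
  then show False by simp
qed

definition step_seq :: "int \<Rightarrow> complex" where
  "step_seq k = (if 0 \<le> k then 1 else 0)"

lemma step_seq_lp: "p = \<infinity> \<Longrightarrow> step_seq \<in> lp p"
  by (rule lp_norm_boundI(1)[of 1]) (auto simp: lp_bound_def step_seq_def)

text \<open>Every mean with \<open>n > 0\<close> takes the value 1 at \<open>k = n\<close> and 0 at
  \<open>k = 0\<close>, so no constant is uniformly closer than \<open>1 / 2\<close>.\<close>

lemma shift_mean_step_seq_not_tendsto:
  assumes "p = \<infinity>" "const_seq c \<in> lp p"
  shows "\<not> (\<lambda>n. lp_norm p (shift_mean step_seq n - const_seq c)) \<longlonglongrightarrow> 0"
proof
  assume lim: "(\<lambda>n. lp_norm p (shift_mean step_seq n - const_seq c)) \<longlonglongrightarrow> 0"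
  have le: "norm (shift_mean step_seq n k - c) \<le> lp_norm p (shift_mean step_seq n - const_seq c)" for n k
    using norm_le_lp_norm[OF lp_diff(1)[OF shift_mean_bound(1)[OF step_seq_lp] assms(2)], OF assms(1), of n k]
    by (simp add: const_seq_def)
  have "\<forall>\<^sub>F n in sequentially. 1 / 2 \<le> lp_norm p (shift_mean step_seq n - const_seq c)"
    using eventually_gt_at_top[of 0]
  proof eventually_elim
    case (elim n)
    have "shift_mean step_seq n (int n) = 1" "shift_mean step_seq n 0 = 0"
      using elim by (auto simp: shift_mean_eq step_seq_def)
    then show ?case
      using le[of n "int n"] le[of n 0] norm_triangle_ineq4[of "1 - c" "0 - c"] by simp
  qed
  then have "(1 / 2 :: real) \<le> 0" by (rule tendsto_lowerbound[OF lim]) simp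
  then show False by simp
qed

end

section \<open>Dyadic sequences and optimality of the rates\<close>

context lp_exponent
begin

text \<open>The sequence has modulus \<open>w i * 2 ^ i powr (- 1 / q)\<close> on the dyadic block from \<open>2 ^ i\<close> to
  \<open>2 ^ (i + 1)\<close>, so the block has norm \<open>w i\<close>. For \<open>p = \<infinity>\<close> the weight is just \<open>w i\<close>, because then
  \<open>q = 0\<close> and \<open>1 / q = 0\<close>.\<close>

definition dyadic_seq :: "(nat \<Rightarrow> real) \<Rightarrow> (nat \<Rightarrow> complex) \<Rightarrow> int \<Rightarrow> complex" where
  "dyadic_seq w z k = (if k \<le> 0 then 0
     else let i = floor_log (nat k)
          in of_real (w i * (2 ^ i) powr (- (1 / q))) * z i ^ nat k)"

lemma norm_dyadic_seq:
  assumes "\<And>i. 0 \<le> w i" "\<And>i. norm (z i) = 1" "0 < k"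
  shows "norm (dyadic_seq w z k) = w (floor_log (nat k)) * (2 ^ floor_log (nat k)) powr (- (1 / q))"
  using assms by (simp add: dyadic_seq_def Let_def norm_mult norm_power)

text \<open>For finite \<open>p\<close>, block \<open>i\<close> contributes
  \<open>w i powr q\<close> to the sum of powers, which is at most \<open>w i\<close> because
  \<open>0 \<le> w i \<le> 1\<close> and \<open>1 \<le> q\<close>.\<close>

lemma dyadic_seq_lp:
  assumes w: "\<And>i. 0 \<le> w i" "\<And>i. w i \<le> 1" "summable w" and z: "\<And>i. norm (z i) = 1"
  shows "dyadic_seq w z \<in> lp p"
proof (cases "p = \<infinity>")
  case True
  have "norm (dyadic_seq w z k) \<le> 1" for k
  proof (cases "k \<le> 0")
    case False
    then show ?thesis using norm_dyadic_seq[OF w(1) z, of k] w(2) True by simp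
  qed (simp add: dyadic_seq_def)
  then show ?thesis
    using True by (intro lp_norm_boundI(1)[of 1]) (auto simp: lp_bound_def)
next
  case False
  note q = q_ge_1[OF False]
  define g where "g i = (w i * (2 ^ i) powr (- (1 / q))) powr q" for i
  have g: "2 ^ i * g i \<le> w i" for i
  proof -
    have "((2 ^ i) powr (- (1 / q))) powr q = 1 / 2 ^ i"
      unfolding powr_powr using q by (simp add: powr_minus_divide)
    then have "2 ^ i * g i = w i powr q"
      by (simp add: g_def powr_mult)
    also have "\<dots> \<le> w i powr 1" using w q by (intro powr_mono') auto
    finally show ?thesis using w(1)[of i] by simp
  qed
  have "(\<Sum>k\<in>F. norm (dyadic_seq w z k) powr q) \<le> (suminf w powr (1 / q)) powr q" if F: "finite F" for F
  proof -
    obtain N where N: "nat ` F \<subseteq> {..<N}" using finite_nat_iff_bounded F by blast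
    have N2: "N < 2 ^ N" by (rule less_exp)
    have sub: "F \<inter> {1..} \<subseteq> int ` {1..<2 ^ N}"
    proof
      fix k assume k: "k \<in> F \<inter> {1..}"
      then have "nat k < N" using N by auto
      then have "nat k < 2 ^ N" using N2 by (rule less_trans)
      then show "k \<in> int ` {1..<2 ^ N}" using k by (intro image_eqI[of _ _ "nat k"]) auto
    qed
    have "(\<Sum>k\<in>F. norm (dyadic_seq w z k) powr q) = (\<Sum>k\<in>F \<inter> {1..}. norm (dyadic_seq w z k) powr q)"
      using F q by (intro sum.mono_neutral_right) (auto simp: dyadic_seq_def)
    also have "\<dots> \<le> (\<Sum>k\<in>int ` {1..<2 ^ N}. norm (dyadic_seq w z k) powr q)"
      using sub by (intro sum_mono2) auto
    also have "\<dots> = (\<Sum>k\<in>{1..<2 ^ N}. norm (dyadic_seq w z (int k)) powr q)"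
      by (subst sum.reindex) auto
    also have "\<dots> = (\<Sum>k\<in>{1..<2 ^ N}. g (floor_log k))"
      unfolding g_def by (rule sum.cong) (auto simp: norm_dyadic_seq[OF w(1) z])
    also have "\<dots> = (\<Sum>i<N. 2 ^ i * g i)" by (rule sum_floor_log)
    also have "\<dots> \<le> (\<Sum>i<N. w i)" by (rule sum_mono) (rule g)
    also have "\<dots> \<le> suminf w" using w by (intro sum_le_suminf) auto
    also have "\<dots> = (suminf w powr (1 / q)) powr q"
      using q suminf_nonneg[OF w(3,1)] by (simp add: powr_powr)
    finally show ?thesis .
  qed
  then show ?thesis
    using False by (intro lp_norm_boundI(1)[of "suminf w powr (1 / q)"]) (auto simp: lp_bound_def)
qed

end

context lp_averaging
begin

text \<open>\<open>T^n (I - S)\<close> at \<open>k\<close> sees only the entries of \<open>u\<close>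
  from \<open>k - (n + 1)\<close> to \<open>k\<close>. Where these are geometric, the binomial
  theorem evaluates the sum.\<close>

lemma solution_geometric:
  assumes "\<And>j. j \<le> Suc n \<Longrightarrow> u (k - int j) = u k * z ^ j"
  shows "solution \<alpha> (coboundary u) n k = u k * (1 - z) * (of_real (1 - \<alpha>) + of_real \<alpha> * z) ^ n"
proof -
  have "solution \<alpha> (coboundary u) n k = (\<Sum>j\<le>n. of_real (Bernstein n j \<alpha>) * (u k * z ^ j * (1 - z)))"
    unfolding solution_eq
  proof (rule sum.cong)
    fix j assume "j \<in> {..n}"
    then have "u (k - int j) = u k * z ^ j" "u (k - int j - 1) = u k * z ^ Suc j"
      using assms[of j] assms[of "Suc j"] by (auto simp: diff_diff_eq add.commute)
    then show "of_real (Bernstein n j \<alpha>) * coboundary u (k - int j)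
        = of_real (Bernstein n j \<alpha>) * (u k * z ^ j * (1 - z))"
      by (simp add: coboundary_def right_shift_def algebra_simps)
  qed simp
  also have "\<dots> = u k * (1 - z)
      * (\<Sum>j\<le>n. of_nat (n choose j) * (of_real \<alpha> * z) ^ j * of_real (1 - \<alpha>) ^ (n - j))"
    unfolding sum_distrib_left by (rule sum.cong) (auto simp: Bernstein_def power_mult_distrib)
  also have "\<dots> = u k * (1 - z) * (of_real \<alpha> * z + of_real (1 - \<alpha>)) ^ n"
    by (simp only: binomial_ring)
  finally show ?thesis by (simp only: add.commute)
qed

text \<open>With \<open>s = \<alpha> * (1 - \<alpha>) \<le> 1 / 4\<close> the squared modulus is
  \<open>(1 - s / n) ^ n\<close>, and Bernoulli's inequality bounds it below by
  \<open>1 - s \<ge> 3 / 4\<close>.\<close>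

lemma cmod_symbol_ge:
  fixes z :: complex
  assumes z: "norm z = 1" "norm (1 - z) = 1 / sqrt (real n)" and n: "n > 0"
  shows "1 / 2 \<le> norm ((of_real (1 - \<alpha>) + of_real \<alpha> * z) ^ n)"
proof (rule power2_le_imp_le)
  define s where "s = \<alpha> * (1 - \<alpha>)"
  have "0 \<le> (1 - 2 * \<alpha>)\<^sup>2" by simp
  then have s: "s \<le> 1 / 4" by (simp add: s_def power2_eq_square algebra_simps)
  have "s / real n \<le> s / 1" using \<alpha> n by (intro divide_left_mono) (auto simp: s_def)
  then have "-1 \<le> - (s / real n)" using s by simp
  from Bernoulli_inequality[OF this, of n] have "3 / 4 \<le> (1 - s / real n) ^ n"
    using n s by simp
  also have "(1 - s / real n) = (norm (of_real (1 - \<alpha>) + of_real \<alpha> * z))\<^sup>2"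
    unfolding cmod_convex_comb_sq[OF z(1)] z(2) by (simp add: power_divide s_def)
  finally have "3 / 4 \<le> (norm ((of_real (1 - \<alpha>) + of_real \<alpha> * z) ^ n))\<^sup>2"
    by (simp only: norm_power power_mult[symmetric] mult.commute)
  then show "(1 / 2)\<^sup>2 \<le> (norm ((of_real (1 - \<alpha>) + of_real \<alpha> * z) ^ n))\<^sup>2"
    by (simp add: power2_eq_square)
qed simp

text \<open>At time \<open>n = 2 ^ j\<close> the last half of the block \<open>j + 2\<close> has not yet felt its left end, so there
  the solution is still an eigenvector.\<close>

lemma dyadic_seq_lower_bound:
  assumes w: "\<And>i. 0 \<le> w i" "\<And>i. w i \<le> 1" "summable w"
    and z: "\<And>i. norm (z i) = 1" "norm (1 - z (j + 2)) = 1 / sqrt (2 ^ j)"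
  shows "w (j + 2) / (4 * sqrt (2 ^ j)) \<le> lp_norm p (solution \<alpha> (coboundary (dyadic_seq w z)) (2 ^ j))"
proof -
  define u n i where "u = dyadic_seq w z" and "n = (2::nat) ^ j" and "i = j + 2"
  \<comment> \<open>A lower bound for the entries: the modulus of \<open>u\<close> on the block,
    times the distance \<open>1 / sqrt n\<close> of \<open>z i\<close> from 1, times
    \<open>1 / 2\<close> for the power of the symbol.\<close>
  define a where "a = w i * (2 ^ i) powr (- (1 / q)) / (2 * sqrt (real n))"
  have n: "n > 0" "2 ^ i = 4 * real n" by (auto simp: n_def i_def power_add)
  have a0: "0 \<le> a" using w(1) by (simp add: a_def)
  have fl: "floor_log (nat k) = i" if "4 * int n \<le> k" "k < 8 * int n" for k
    using that by (intro floor_log_eqI) (auto simp: n_def i_def power_add nat_le_iff le_nat_iff nat_less_iff)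
  have u: "u k = of_real (w i * (2 ^ i) powr (- (1 / q))) * z i ^ nat k"
    if "4 * int n \<le> k" "k < 8 * int n" for k
    using that n fl[OF that] by (simp add: u_def dyadic_seq_def)
  have a: "a \<le> norm (solution \<alpha> (coboundary u) n k)" if k: "6 * int n \<le> k" "k < 8 * int n" for k
  proof -
    have zz: "z i * cnj (z i) = 1" using z(1)[of i] by (simp add: complex_norm_square[symmetric])
    \<comment> \<open>A step to the left divides by \<open>z i\<close>, that is, multiplies by its
      conjugate. From \<open>k \<ge> 6 * n\<close> and \<open>m \<le> n + 1\<close> follows
      \<open>k - m \<ge> 4 * n\<close>, so the block is not left.\<close>
    have "u (k - int m) = u k * cnj (z i) ^ m" if "m \<le> Suc n" for m
    proof -
      have "z i ^ nat k = z i ^ nat (k - int m) * z i ^ m"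
        using that k n(1) by (simp flip: power_add add: nat_diff_distrib)
      then have "z i ^ nat k * cnj (z i) ^ m = z i ^ nat (k - int m) * (z i * cnj (z i)) ^ m"
        by (simp add: power_mult_distrib)
      then show ?thesis using that k n(1) by (simp add: u zz)
    qed
    then have "solution \<alpha> (coboundary u) n k
        = u k * (1 - cnj (z i)) * (of_real (1 - \<alpha>) + of_real \<alpha> * cnj (z i)) ^ n"
      by (rule solution_geometric)
    moreover have nz: "norm (1 - cnj (z i)) = 1 / sqrt (real n)"
      using z(2) complex_mod_cnj[of "1 - z i"] by (simp add: n_def i_def)
    moreover have "1 / 2 \<le> norm ((of_real (1 - \<alpha>) + of_real \<alpha> * cnj (z i)) ^ n)"
      using nz z(1)[of i] n(1) by (intro cmod_symbol_ge) auto
    then have "norm (u k) * (1 / sqrt (real n)) * (1 / 2)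
      \<le> norm (u k) * (1 / sqrt (real n)) * norm ((of_real (1 - \<alpha>) + of_real \<alpha> * cnj (z i)) ^ n)"
      by (intro mult_left_mono) auto
    moreover have "norm (u k) = w i * (2 ^ i) powr (- (1 / q))"
      using k w(1)[of i] z(1)[of i] by (simp add: u norm_mult norm_power)
    ultimately show ?thesis by (simp add: norm_mult a_def)
  qed
  have lp: "solution \<alpha> (coboundary u) n \<in> lp p"
    unfolding u_def by (intro solution_bound coboundary_lp dyadic_seq_lp w z)
  have "w i / (4 * sqrt (real n)) \<le> lp_norm p (solution \<alpha> (coboundary u) n)"
  proof (cases "p = \<infinity>")
    case True
    have "w i / (4 * sqrt (real n)) \<le> a"
      using w(1)[of i] n(1) True by (simp add: a_def field_simps)
    also have "\<dots> \<le> lp_norm p (solution \<alpha> (coboundary u) n)"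
      using order_trans[OF a[of "6 * int n"] norm_le_lp_norm[OF lp]] n(1) by simp
    finally show ?thesis .
  next
    case False
    note q = q_ge_1[OF False]
    \<comment> \<open>Only \<open>2 * n\<close> of the \<open>4 * n\<close> indices of the block are
      used. This loss of one half is covered by replacing 2 by 4 in the denominator, as
      \<open>(1 / 2) powr q \<le> 1 / 2\<close>.\<close>
    have "(w i / (4 * sqrt (real n))) powr q = (1 / 2) powr q * (w i / (2 * sqrt (real n))) powr q"
      by (simp flip: powr_mult)
    also have "\<dots> \<le> 1 / 2 * (w i / (2 * sqrt (real n))) powr q"
      using q powr_mono'[of 1 q "1 / 2"] by (intro mult_right_mono) auto
    also have "\<dots> = 2 * real n * a powr q"
      using n q by (simp add: a_def powr_mult powr_divide powr_powr powr_minus n(2)[symmetric] field_simps)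
    also have "\<dots> = real (card {6 * int n..<8 * int n}) * a powr q" by simp
    also have "\<dots> \<le> lp_norm p (solution \<alpha> (coboundary u) n) powr q"
      by (rule lp_norm_ge_card[OF False lp]) (auto intro: a a0)
    finally show ?thesis
      using q lp_norm_nonneg[OF lp] by (meson less_le_trans not_le powr_less_mono2 zero_less_one)
  qed
  then show ?thesis by (simp add: u_def n_def i_def)
qed

text \<open>Block \<open>i\<close> is tested at time \<open>2 ^ (i - 2)\<close>. If the solution
  were \<open>O(r)\<close>, the lower bound there would give \<open>w \<in> O(f)\<close> for the
  rescaled rate \<open>f\<close>, and \<open>w\<close> is chosen to violate this.\<close>

lemma rate_optimal:
  assumes r: "r \<in> o(\<lambda>n. real n powr (- 1 / 2))"
  obtains u where "u \<in> lp p" "(\<lambda>n. lp_norm p (solution \<alpha> (coboundary u) n)) \<notin> O(r)"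
proof -
  have pow: "filterlim (\<lambda>j. 2 ^ j :: nat) at_top sequentially"
    by (rule filterlim_subseq) (simp add: strict_mono_def)
  \<comment> \<open>The proposed rate relative to \<open>n powr (- 1 / 2)\<close> at
    \<open>n = 2 ^ (i - 2)\<close>. The truncated subtraction affects only \<open>i < 2\<close>,
    while the limit and the comparison concern \<open>i = j + 2\<close>.\<close>
  define f where "f i = r (2 ^ (i - 2)) * sqrt (2 ^ (i - 2))" for i
  have "(\<lambda>n. r n / real n powr (- 1 / 2)) \<longlonglongrightarrow> 0"
    using r by (rule smalloD_tendsto)
  moreover have "r n / real n powr (- 1 / 2) = r n * sqrt (real n)" for n
    using powr_minus_divide[of "real n" "1 / 2"] by (simp add: powr_half_sqrt)
  ultimately have "(\<lambda>n. r n * sqrt (real n)) \<longlonglongrightarrow> 0" by simp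
  from filterlim_compose[OF this pow] have "(\<lambda>j. f (j + 2)) \<longlonglongrightarrow> 0"
    by (simp add: f_def)
  then have f: "f \<longlonglongrightarrow> 0" by (rule LIMSEQ_offset)
  obtain w where w: "\<And>i. 0 \<le> w i" "\<And>i. w i \<le> 1" "summable w" "w \<notin> O(f)"
    by (rule summable_not_bigo[OF f]) blast
  have "\<exists>z :: complex. norm z = 1 \<and> norm (1 - z) = 1 / sqrt (2 ^ (i - 2))" for i :: nat
  proof -
    have "1 \<le> sqrt (2 ^ (i - 2))" by simp
    then have "1 \<le> 2 * sqrt (2 ^ (i - 2))" by linarith
    then have le: "1 / sqrt (2 ^ (i - 2)) \<le> 2" by (simp add: divide_le_eq)
    have nonneg: "0 \<le> 1 / sqrt (2 ^ (i - 2))" by simp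
    obtain z :: complex where "norm z = 1" "norm (1 - z) = 1 / sqrt (2 ^ (i - 2))"
      using unit_at_distance[OF nonneg le] .
    then show ?thesis by blast
  qed
  then obtain z :: "nat \<Rightarrow> complex" where z: "\<And>i. norm (z i) = 1" "\<And>i. norm (1 - z i) = 1 / sqrt (2 ^ (i - 2))"
    by metis
  define u where "u = dyadic_seq w z"
  show thesis
  proof
    show u_lp: "u \<in> lp p" unfolding u_def by (rule dyadic_seq_lp[OF w(1-3) z(1)])
    show "(\<lambda>n. lp_norm p (solution \<alpha> (coboundary u) n)) \<notin> O(r)"
    proof
      assume "(\<lambda>n. lp_norm p (solution \<alpha> (coboundary u) n)) \<in> O(r)"
      then obtain c where c: "c > 0" "\<forall>\<^sub>F n in sequentially.
          norm (lp_norm p (solution \<alpha> (coboundary u) n)) \<le> c * norm (r n)"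
        by (rule landau_o.bigE)
      have "\<forall>\<^sub>F j in sequentially. norm (w (j + 2)) \<le> (4 * c) * norm (f (j + 2))"
        using eventually_compose_filterlim[OF c(2) pow]
      proof eventually_elim
        case (elim j)
        have "w (j + 2) / (4 * sqrt (2 ^ j)) \<le> lp_norm p (solution \<alpha> (coboundary u) (2 ^ j))"
          unfolding u_def by (rule dyadic_seq_lower_bound[OF w(1-3) z(1)]) (simp add: z(2))
        also have "\<dots> \<le> c * \<bar>r (2 ^ j)\<bar>" using elim by simp
        finally have "w (j + 2) \<le> c * \<bar>r (2 ^ j)\<bar> * (4 * sqrt (2 ^ j))"
          by (subst (asm) pos_divide_le_eq) auto
        moreover have "norm (f (j + 2)) = \<bar>r (2 ^ j)\<bar> * sqrt (2 ^ j)"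
          by (simp add: f_def abs_mult)
        ultimately show ?case using w(1)[of "j + 2"] by (simp only: real_norm_def abs_of_nonneg mult_ac)
      qed
      then have "\<forall>\<^sub>F i in sequentially. norm (w i) \<le> (4 * c) * norm (f i)"
        by (rule eventually_sequentially_seg[THEN iffD1])
      then have "w \<in> O(f)" by (rule bigoI)
      with w(4) show False ..
    qed
  qed
qed

section \<open>Constant limits and assembly of the statements\<close>

text \<open>Norm convergence passes to each coordinate, so the limit is a fixed point of the
  recursion.\<close>

lemma solution_limit_const:
  assumes x: "x \<in> lp p" and z: "z \<in> lp p" "(\<lambda>n. lp_norm p (solution \<alpha> x n - z)) \<longlonglongrightarrow> 0"
  shows "z = const_seq (z 0)"
proof (rule solution_fixed)
  have lim: "(\<lambda>n. solution \<alpha> x n k) \<longlonglongrightarrow> z k" for k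
  proof (rule Lim_null[THEN iffD2], rule tendsto_norm_zero_cancel, rule tendsto_sandwich[OF _ _ tendsto_const z(2)])
    show "\<forall>\<^sub>F n in sequentially. norm (solution \<alpha> x n k - z k) \<le> lp_norm p (solution \<alpha> x n - z)"
      using norm_le_lp_norm[OF lp_diff(1)[OF solution_bound(1)[OF x] z(1)], where k=k] by simp
  qed simp
  show "z = (\<lambda>k. of_real (1 - \<alpha>) * z k + of_real \<alpha> * z (k - 1))"
  proof
    fix k
    have "(\<lambda>n. solution \<alpha> x (Suc n) k) \<longlonglongrightarrow> of_real (1 - \<alpha>) * z k + of_real \<alpha> * z (k - 1)"
      by (auto intro!: tendsto_intros lim)
    then show "z k = of_real (1 - \<alpha>) * z k + of_real \<alpha> * z (k - 1)"
      using LIMSEQ_Suc[OF lim] LIMSEQ_unique by blast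
  qed
qed (use \<alpha> in simp)

text \<open>Eventually and not always, since the mean with \<open>n = 0\<close> sends constants to
  0.\<close>

lemma shift_mean_sub_const:
  "\<forall>\<^sub>F n in sequentially. lp_norm p (shift_mean (x - const_seq c) n) = lp_norm p (shift_mean x n - const_seq c)"
  using eventually_gt_at_top[of 0]
  by eventually_elim (simp add: shift_mean_diff shift_mean_const)

lemma solution_sub_const: "solution \<alpha> (x - const_seq c) n = solution \<alpha> x n - const_seq c"
  by (simp add: solution_diff solution_const)

text \<open>Solutions fix constants, and so do the means for \<open>n > 0\<close>; subtracting the
  constant reduces the claim to limit 0.\<close>

lemma solution_tendsto_const_iff:
  assumes "x \<in> lp p" "const_seq c \<in> lp p"
  shows "(\<lambda>n. lp_norm p (solution \<alpha> x n - const_seq c)) \<longlonglongrightarrow> 0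
    \<longleftrightarrow> (\<lambda>n. lp_norm p (shift_mean x n - const_seq c)) \<longlonglongrightarrow> 0"
  using solution_tendsto_0_iff[OF lp_diff(1)[OF assms]] tendsto_cong[OF shift_mean_sub_const]
  by (simp add: solution_sub_const)

lemma solution_converges_iff:
  assumes "x \<in> lp p"
  shows "solution_converges p \<alpha> x \<longleftrightarrow>
    (\<exists>c. const_seq c \<in> lp p \<and> (\<lambda>n. lp_norm p (shift_mean x n - const_seq c)) \<longlonglongrightarrow> 0)"
  unfolding solution_converges_def
  using solution_limit_const[OF assms] solution_tendsto_const_iff[OF assms] by metis

lemma all_solutions_converge_iff:
  "(\<forall>x\<in>lp p. solution_converges p \<alpha> x) \<longleftrightarrow> 1 < p \<and> p < \<infinity>"
proof
  assume "1 < p \<and> p < \<infinity>"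
  then have "const_seq 0 \<in> lp p \<and> (\<lambda>n. lp_norm p (shift_mean x n - const_seq 0)) \<longlonglongrightarrow> 0" if "x \<in> lp p" for x
    using shift_mean_tendsto_0[OF _ _ that] lp_zero(1) by (simp add: const_seq_def fun_diff_def)
  then show "\<forall>x\<in>lp p. solution_converges p \<alpha> x"
    using solution_converges_iff by blast
next
  assume all: "\<forall>x\<in>lp p. solution_converges p \<alpha> x"
  have "p \<noteq> \<infinity>"
    using all solution_converges_iff step_seq_lp shift_mean_step_seq_not_tendsto by blast
  moreover have "p \<noteq> 1"
  proof
    assume p: "p = 1"
    obtain c where "const_seq c \<in> lp p" "(\<lambda>n. lp_norm p (shift_mean (unit_seq 0) n - const_seq c)) \<longlonglongrightarrow> 0"
      using all solution_converges_iff unit_seq_lp by blast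
    moreover from this have "c = 0" using const_seq_in_lp_iff p by simp
    ultimately show False
      using shift_mean_unit_seq_not_tendsto_0[OF p] by (simp add: const_seq_def fun_diff_def)
  qed
  ultimately show "1 < p \<and> p < \<infinity>" using p_ge_1 by (simp add: less_le)
qed

lemma solution_const_bigo:
  assumes "x \<in> lp p" "const_seq c \<in> lp p"
    "(\<lambda>n. lp_norm p (shift_mean x n - const_seq c)) \<in> O(\<lambda>n. 1 / real n)"
  shows "(\<lambda>n. lp_norm p (solution \<alpha> x n - const_seq c)) \<in> O(\<lambda>n. real n powr (- 1 / 2))"
  using solution_bigo[OF lp_diff(1)[OF assms(1,2)]] landau_o.big.in_cong[OF shift_mean_sub_const] assms(3)
  by (simp add: solution_sub_const)

end

theorem corollary3p1:
  fixes \<alpha> :: real and p :: ereal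
  assumes "0 < \<alpha>" and "\<alpha> < 1" and "1 \<le> p"
  shows
   "\<comment> \<open>(a)\<close>
    (\<forall>x0\<in>lp p.
       solution_converges p \<alpha> x0 \<longleftrightarrow>
       (\<exists>c. const_seq c \<in> lp p \<and> (\<lambda>n. lp_norm p (shift_mean x0 n - const_seq c)) \<longlonglongrightarrow> 0)) \<and>
    (\<forall>x0\<in>lp p. \<forall>c.
       const_seq c \<in> lp p \<and> (\<lambda>n. lp_norm p (shift_mean x0 n - const_seq c)) \<longlonglongrightarrow> 0 \<longrightarrow>
       (\<lambda>n. lp_norm p (solution \<alpha> x0 n - const_seq c)) \<longlonglongrightarrow> 0) \<and>
    ((\<forall>x0\<in>lp p. solution_converges p \<alpha> x0) \<longleftrightarrow> 1 < p \<and> p < \<infinity>) \<and>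
    (p < \<infinity> \<longrightarrow> (\<forall>c. const_seq c \<in> lp p \<longleftrightarrow> c = 0)) \<and>
    \<comment> \<open>(b)\<close>
    (\<forall>x0\<in>lp p. \<forall>c.
       const_seq c \<in> lp p \<and>
       (\<lambda>n. lp_norm p (shift_mean x0 n - const_seq c)) \<in> O(\<lambda>n. 1 / real n) \<longrightarrow>
       (\<lambda>n. lp_norm p (solution \<alpha> x0 n - const_seq c)) \<in> O(\<lambda>n. real n powr (- 1 / 2))) \<and>
    \<comment> \<open>(c)\<close>
    (\<forall>x0\<in>lp p.
       (\<lambda>n. lp_norm p (solution \<alpha> x0 (n + 1) - solution \<alpha> x0 n)) \<in> O(\<lambda>n. real n powr (- 1 / 2))) \<and>
    \<comment> \<open>optimality of the rates in (b) and (c)\<close>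
    (\<forall>r :: nat \<Rightarrow> real.
       (\<forall>n\<ge>1. 0 < r n) \<and> r \<in> o(\<lambda>n. real n powr (- 1 / 2)) \<longrightarrow>
       \<not> (\<forall>x0\<in>lp p. \<forall>c.
            const_seq c \<in> lp p \<and>
            (\<lambda>n. lp_norm p (shift_mean x0 n - const_seq c)) \<in> O(\<lambda>n. 1 / real n) \<longrightarrow>
            (\<lambda>n. lp_norm p (solution \<alpha> x0 n - const_seq c)) \<in> O(r)) \<and>
       \<not> (\<forall>x0\<in>lp p.
            (\<lambda>n. lp_norm p (solution \<alpha> x0 (n + 1) - solution \<alpha> x0 n)) \<in> O(r)))"
proof -
  interpret lp_averaging p \<alpha> by unfold_locales fact+
  \<comment> \<open>One \<open>u\<close> refutes both improved rates: (b) fails at the initial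
    vector \<open>coboundary u\<close> with \<open>c = 0\<close>, and (c) at \<open>u\<close>
    itself, whose steps have \<open>\<alpha>\<close> times the norm of the solution from
    \<open>coboundary u\<close>.\<close>
  have optimal: "\<not> (\<forall>x0\<in>lp p. \<forall>c.
            const_seq c \<in> lp p \<and>
            (\<lambda>n. lp_norm p (shift_mean x0 n - const_seq c)) \<in> O(\<lambda>n. 1 / real n) \<longrightarrow>
            (\<lambda>n. lp_norm p (solution \<alpha> x0 n - const_seq c)) \<in> O(r)) \<and>
       \<not> (\<forall>x0\<in>lp p.
            (\<lambda>n. lp_norm p (solution \<alpha> x0 (n + 1) - solution \<alpha> x0 n)) \<in> O(r))"
    if r: "r \<in> o(\<lambda>n. real n powr (- 1 / 2))" for r :: "nat \<Rightarrow> real"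
  proof -
    obtain u where u: "u \<in> lp p" "(\<lambda>n. lp_norm p (solution \<alpha> (coboundary u) n)) \<notin> O(r)"
      using rate_optimal[OF r] .
    have z: "x - const_seq 0 = x" for x by (simp add: const_seq_def fun_eq_iff)
    have "const_seq 0 \<in> lp p" using lp_zero(1) by (simp add: const_seq_def)
    then have "\<exists>x0\<in>lp p. \<exists>c. const_seq c \<in> lp p \<and>
        (\<lambda>n. lp_norm p (shift_mean x0 n - const_seq c)) \<in> O(\<lambda>n. 1 / real n) \<and>
        (\<lambda>n. lp_norm p (solution \<alpha> x0 n - const_seq c)) \<notin> O(r)"
      using u(2) shift_mean_coboundary(1)[OF u(1)]
      by (intro bexI[of _ "coboundary u"] exI[of _ 0] coboundary_lp u(1)) (simp add: z)
    moreover have "(\<lambda>n. lp_norm p (solution \<alpha> u (n + 1) - solution \<alpha> u n)) \<notin> O(r)"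
      using u(2) \<alpha> unfolding solution_step_norm[OF u(1)] by simp
    ultimately show ?thesis using u(1) by fast
  qed
  show ?thesis
  proof (intro conjI)
    show "\<forall>x0\<in>lp p. solution_converges p \<alpha> x0 \<longleftrightarrow>
       (\<exists>c. const_seq c \<in> lp p \<and> (\<lambda>n. lp_norm p (shift_mean x0 n - const_seq c)) \<longlonglongrightarrow> 0)"
      by (intro ballI solution_converges_iff)
    show "\<forall>x0\<in>lp p. \<forall>c.
       const_seq c \<in> lp p \<and> (\<lambda>n. lp_norm p (shift_mean x0 n - const_seq c)) \<longlonglongrightarrow> 0 \<longrightarrow>
       (\<lambda>n. lp_norm p (solution \<alpha> x0 n - const_seq c)) \<longlonglongrightarrow> 0"
      by (simp add: solution_tendsto_const_iff)
    show "p < \<infinity> \<longrightarrow> (\<forall>c. const_seq c \<in> lp p \<longleftrightarrow> c = 0)"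
      using const_seq_in_lp_iff by auto
    show "\<forall>x0\<in>lp p. \<forall>c.
       const_seq c \<in> lp p \<and>
       (\<lambda>n. lp_norm p (shift_mean x0 n - const_seq c)) \<in> O(\<lambda>n. 1 / real n) \<longrightarrow>
       (\<lambda>n. lp_norm p (solution \<alpha> x0 n - const_seq c)) \<in> O(\<lambda>n. real n powr (- 1 / 2))"
      by (intro ballI allI impI, elim conjE) (rule solution_const_bigo)
  qed (rule all_solutions_converge_iff, intro ballI solution_step_bigo, assumption,
      intro allI impI, elim conjE, rule optimal, assumption)
qed

end
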